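(* Fix a prime power $q$ and a real number $\varepsilon>0$. For each $n$ let $k=k(n)$ be an integer with $1\le k\le n$, and let $m:=\min\{k,n-k\}$. Let $\mathcal{C}\subseteq\mathbb{F}_q^n$ be a uniformly random $k$-dimensional $\mathbb{F}_q$-linear subspace. If $m\ge(2+\varepsilon)\log_q n$ for all sufficiently large $n$, then $\mathcal{C}$ has a trivial (monomial) automorphism group with probability tending to one as $n\to\infty$, i.e. $\lim_{n\to\infty}\Pr[\operatorname{MAut}(\mathcal{C})=\operatorname{MAut}_0]=1$.
   Context: Vectors in $\mathbb{F}_q^n$ are row vectors. The monomial group $M_{n,q}=(\mathbb{F}_q^* )^n\rtimes S_n$ is the group of all $n\times n$ monomial matrices $\mathbf{M}=\mathbf{D}\mathbf{P}$ over $\mathbb{F}_q$, where $\mathbf{D}$ is a diagonal matrix with nonzero diagonal entries and $\mathbf{P}$ is a permutation matrix; it acts on $\mathbb{F}_q^n$ by $\mathbf{x}\mapsto\mathbf{x}\mathbf{M}$. For a linear code (linear subspace) $\mathcal{C}\subseteq\mathbb{F}_q^n$, put $\mathcal{C}\mathbf{M}=\{\mathbf{c}\mathbf{M}:\mathbf{c}\in\mathcal{C}\}$ and define the (monomial) automorphism group $\operatorname{MAut}(\mathcal{C})=\{\mathbf{M}\in M_{n,q}:\mathcal{C}\mathbf{M}=\mathcal{C}\}$. Let $\operatorname{MAut}_0:=\mathbb{F}_q^*\mathbf{I}_n$ be the group of nonzero scalar matrices, which is contained in $\operatorname{MAut}(\mathcal{C})$ for every linear code $\mathcal{C}$. The automorphism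 group of $\mathcal{C}$ is called trivial if $\operatorname{MAut}(\mathcal{C})=\operatorname{MAut}_0$. *)

theory Defs
  imports
    "HOL-Probability.Probability_Mass_Function"
    "Jordan_Normal_Form.VS_Connect"
begin

text \<open>
  The field is a type \<open>'a\<close> of class \<open>{finite, field}\<close>, so \<open>q = CARD('a)\<close>.
  Coordinates are numbered \<open>0, \<dots>, n - 1\<close>.
\<close>

text \<open>
  Vectors of the matrix library carry no row or column orientation and only \<open>M *\<^sub>v x\<close> is provided;
  the following is the product of the row vector \<open>x\<close> with \<open>M\<close>.
\<close>

definition row_vec_mult :: "'a :: semiring_0 Matrix.vec \<Rightarrow> 'a mat \<Rightarrow> 'a vec" where
  "row_vec_mult x M = Matrix.vec (dim_col M) (\<lambda>j. scalar_prod x (Matrix.col M j))"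

definition perm_matrix :: "nat \<Rightarrow> (nat \<Rightarrow> nat) \<Rightarrow> 'a :: field mat" where
  "perm_matrix n \<sigma> = Matrix.mat n n (\<lambda>(i, j). if j = \<sigma> i then 1 else 0)"

definition monomial_group :: "nat \<Rightarrow> 'a :: field mat set" where
  "monomial_group n =
     {mat_diag n d * perm_matrix n \<sigma> | d \<sigma>. (\<forall>i<n. d i \<noteq> 0) \<and> \<sigma> permutes {..<n}}"

definition linear_codes :: "nat \<Rightarrow> nat \<Rightarrow> 'a :: field Matrix.vec set set" where
  "linear_codes n k =
     {C. VectorSpace.subspace class_ring C (module_vec TYPE('a) n) \<and>
         vectorspace.dim class_ring ((module_vec TYPE('a) n)\<lparr>carrier := C\<rparr>) = k}"

definition MAut :: "nat \<Rightarrow> 'a :: field Matrix.vec set \<Rightarrow> 'a mat set" where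
  "MAut n C = {M \<in> monomial_group n. (\<lambda>c. row_vec_mult c M) ` C = C}"

definition MAut0 :: "nat \<Rightarrow> 'a :: field mat set" where
  "MAut0 n = {c \<cdot>\<^sub>m 1\<^sub>m n | c. c \<noteq> 0}"

definition random_code :: "nat \<Rightarrow> nat \<Rightarrow> 'a :: {finite, field} Matrix.vec set pmf" where
  "random_code n k = pmf_of_set (linear_codes n k)"

end

theory Submission
  imports Defs "HOL-Library.Function_Algebras" "HOL-Real_Asymp.Real_Asymp"
begin

text \<open>
  Union bound over the non-scalar monomial maps \<open>T\<close>, sorted by \<open>r = min {rank (T - c) | c}\<close>.
  Such a \<open>T\<close> is scalar outside at most \<open>2r\<close> coordinates, so there are at most
  \<open>q (q n) ^ min (2r) n\<close> of them. By duality we may assume \<open>2k \<le> n\<close>.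
  For \<open>r \<le> \<surd>n\<close>, an invariant code either lies in the largest eigenspace of \<open>T\<close>, which has
  probability at most \<open>q ^ (- r k)\<close>, or meets the image of \<open>T - c\<close>, an \<open>r\<close>-dimensional space,
  which has negligible probability; here \<open>k \<ge> (2 + \<epsilon>) log\<^sub>q n\<close> is exactly what beats
  \<open>n ^ (2r)\<close>. For \<open>r > \<surd>n\<close>, build the code from successive random vectors: one whose image
  is not yet in the span brings in a second vector for free, and there are few others.
\<close>

section \<open>Counting subspaces over a finite field\<close>

text \<open>Two regimes are needed because each bound fails in the range of the other. For k near
  n/2 and r well above n / log n, the chance q^(r+k-n) of meeting the image no longer beats n^(2r)
  maps. For r of order log n, building the code gains too little: at a span of dimension u the
  preimages of the span save only about q^(r-u), which fades as u grows. The construction therefore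
  stops at dimension j, and every dimension up to there is credited with the same saving q^g. The
  preimages demand g to be about r - j at most. A step that adds two vectors saves about q^(n-k),
  that is (n-k)/2 per dimension, which caps g a second time. The size of j comes from these caps.
  While g is about r, any j above 2 log_q n beats n^(2r). Once (n-k)/2 is the cap, the number of
  maps is bounded by (q n)^n. If k is logarithmic, g is about n/2 and j = k suffices. If k is
  larger, only n - k >= n/2 is known, which is what duality provides; then g is about n/4 and j has
  to exceed 4 log_q n.\<close>

locale finite_field_space = vector_space scale
  for scale :: "'a :: {finite, field} \<Rightarrow> 'v :: ab_group_add \<Rightarrow> 'v" (infixr \<open>*s\<close> 75)
begin

lemma card_span_insert:
  assumes U: "subspace U" "finite U" and v: "v \<notin> U"
  shows "card (span (insert v U)) = CARD('a) * card U" "finite (span (insert v U))"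
proof -
  have eq: "span (insert v U) = (\<lambda>(c, x). c *s v + x) ` (UNIV \<times> U)"
  proof -
    have "x \<in> (\<lambda>(c, x). c *s v + x) ` (UNIV \<times> U)" if "x - k *s v \<in> U" for x k
      using that by (intro image_eqI[of _ _ "(k, x - k *s v)"]) auto
    then show ?thesis
      using U(1) by (auto simp: span_insert span_eq_iff[THEN iffD2])
        (metis add_diff_cancel_left')
  qed
  have inj: "inj_on (\<lambda>(c, x). c *s v + x) (UNIV \<times> U)"
  proof (rule inj_onI, clarify)
    fix c x c' x'
    assume x: "x \<in> U" "x' \<in> U" and e: "c *s v + x = c' *s v + x'"
    have "(c - c') *s v = x' - x"
      using e by (simp add: scale_left_diff_distrib algebra_simps)
    then have in_U: "(c - c') *s v \<in> U"
      using U(1) x by (simp add: subspace_diff)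
    have "c = c'"
    proof (rule ccontr)
      assume "c \<noteq> c'"
      then have "v = inverse (c - c') *s ((c - c') *s v)" by simp
      also have "\<dots> \<in> U" using in_U U(1) by (rule subspace_scale[rotated])
      finally show False using v by simp
    qed
    with e show "c = c' \<and> x = x'" by simp
  qed
  show "card (span (insert v U)) = CARD('a) * card U"
    unfolding eq card_image[OF inj] by (simp add: card_cartesian_product)
  show "finite (span (insert v U))"
    unfolding eq using U(2) by simp
qed

lemma card_span_independent:
  assumes "finite B" "independent B"
  shows "card (span B) = CARD('a) ^ card B \<and> finite (span B)"
  using assms
proof (induction B)
  case (insert b B)
  have b: "b \<notin> span B" and B: "independent B"
    using insert.prems insert.hyps by (auto simp: independent_insert)
  have "span (insert b B) = span (insert b (span B))"
    by (simp add: span_insert span_span)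
  then show ?case
    using insert.IH[OF B] card_span_insert[of "span B" b] b insert.hyps by simp
qed simp

lemma card_subspace:
  assumes "subspace U" "finite U"
  obtains d where "card U = CARD('a) ^ d"
proof -
  obtain B where "B \<subseteq> U" "independent B" "U \<subseteq> span B"
    using maximal_independent_subset by metis
  moreover from this have "span B = U"
    using assms by (intro span_subspace) auto
  ultimately show ?thesis
    using that card_span_independent[of B] assms(2) finite_subset by metis
qed

end

lemma CARD_field_ge_2: "CARD('a :: {finite, field}) \<ge> 2"
proof -
  have "card {0, 1 :: 'a} \<le> CARD('a)" by (rule card_mono) auto
  then show ?thesis by simp
qed

text \<open>
  The number of \<open>k\<close>-dimensional subspaces of an \<open>n\<close>-dimensional space that contain a given
  \<open>u\<close>-dimensional one; dividing by its value at \<open>u = 0\<close> gives a probability.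
\<close>
definition gbinom :: "nat \<Rightarrow> nat \<Rightarrow> nat \<Rightarrow> nat \<Rightarrow> real" where
  "gbinom q n k u = (if u \<le> k then \<Prod>i=u..<k. (real q ^ n - real q ^ i) / (real q ^ k - real q ^ i) else 0)"

text \<open>For a fixed \<open>u\<close>-dimensional \<open>U\<close>, both sides count the pairs of
  a \<open>k\<close>-dimensional \<open>C\<close> above \<open>U\<close> and a vector of
  \<open>C\<close> outside \<open>U\<close>.\<close>

lemma gbinom_rec:
  assumes "q \<ge> 2" "u \<le> k"
  shows "gbinom q n k u * (real q ^ k - real q ^ u) = gbinom q n k (Suc u) * (real q ^ n - real q ^ u)"
proof (cases "u = k")
  case False
  then have "u < k" using assms by simp
  moreover have "real q ^ k - real q ^ u \<noteq> 0"
    using assms False by simp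
  ultimately show ?thesis
    by (simp add: gbinom_def prod.atLeast_Suc_lessThan)
qed (simp add: gbinom_def)

lemma gbinom_nonneg:
  assumes "q \<ge> 2" "k \<le> n"
  shows "gbinom q n k u \<ge> 0"
  unfolding gbinom_def using assms
  by (auto intro!: prod_nonneg divide_nonneg_nonneg power_increasing)

lemma gbinom_pos:
  assumes "q \<ge> 2" "k \<le> n" "u \<le> k"
  shows "gbinom q n k u > 0"
  unfolding gbinom_def using assms
  by (auto intro!: prod_pos divide_pos_pos power_strict_increasing)

text \<open>Among the \<open>k\<close>-dimensional spaces above \<open>U\<close>, the fraction
  containing a given further vector is (q^k - q^u) / (q^n - q^u), which is at most q^(k-n).\<close>

lemma gbinom_Suc_le:
  assumes "q \<ge> 2" "k \<le> n"
  shows "real q ^ n * gbinom q n k (Suc u) \<le> real q ^ k * gbinom q n k u"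
proof (cases "u < k")
  case True
  then have "u \<le> k" by simp
  have pos: "real q ^ n - real q ^ u > 0"
    using assms True by simp
  have "(real q ^ k - real q ^ u) * real q ^ n \<le> real q ^ k * (real q ^ n - real q ^ u)"
    using assms by (simp add: algebra_simps mult_left_mono)
  then have "gbinom q n k u * ((real q ^ k - real q ^ u) * real q ^ n)
      \<le> gbinom q n k u * (real q ^ k * (real q ^ n - real q ^ u))"
    by (intro mult_left_mono gbinom_nonneg assms)
  also have "gbinom q n k u * ((real q ^ k - real q ^ u) * real q ^ n)
      = gbinom q n k (Suc u) * real q ^ n * (real q ^ n - real q ^ u)"
    unfolding mult.assoc[symmetric] gbinom_rec[OF assms(1) \<open>u \<le> k\<close>] by (simp only: mult_ac)
  finally have "(real q ^ n * gbinom q n k (Suc u)) * (real q ^ n - real q ^ u)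
      \<le> (real q ^ k * gbinom q n k u) * (real q ^ n - real q ^ u)"
    by (simp only: mult_ac)
  then show ?thesis
    using pos by (rule mult_right_le_imp_le)
next
  case False
  then show ?thesis
    using gbinom_nonneg[OF assms, of u] by (simp add: gbinom_def)
qed

text \<open>The left side counts the subspaces of a fixed space of codimension \<open>r\<close>.
  Each of the \<open>k\<close> factors loses at least q^r, since q^(n-r) - q^i \<le> q^(-r) (q^n -
  q^i).\<close>

lemma gbinom_shrink:
  assumes "q \<ge> 2" "k \<le> n - r" "r \<le> n"
  shows "gbinom q (n - r) k 0 \<le> gbinom q n k 0 / real q ^ (r * k)"
proof -
  have q: "real q ^ n = real q ^ (n - r) * real q ^ r"
    using assms by (simp flip: power_add)
  have "(\<Prod>i=0..<k. (real q ^ (n - r) - real q ^ i) / (real q ^ k - real q ^ i))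
    \<le> (\<Prod>i=0..<k. (1 / real q ^ r) * ((real q ^ n - real q ^ i) / (real q ^ k - real q ^ i)))"
  proof (rule prod_mono, intro conjI)
    fix i assume i: "i \<in> {0..<k}"
    then show "0 \<le> (real q ^ (n - r) - real q ^ i) / (real q ^ k - real q ^ i)"
      using assms by (auto intro!: divide_nonneg_nonneg power_increasing)
    have "real q ^ i / real q ^ r \<le> real q ^ i"
      using assms by (simp add: field_simps)
    then have "real q ^ (n - r) - real q ^ i \<le> (1 / real q ^ r) * (real q ^ n - real q ^ i)"
      using assms(1) by (simp add: q field_simps)
    moreover have "0 \<le> real q ^ k - real q ^ i"
      using i assms by (auto intro!: power_increasing)
    ultimately show "(real q ^ (n - r) - real q ^ i) / (real q ^ k - real q ^ i)
      \<le> (1 / real q ^ r) * ((real q ^ n - real q ^ i) / (real q ^ k - real q ^ i))"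
      unfolding times_divide_eq_right by (rule divide_right_mono)
  qed
  also have "\<dots> = (\<Prod>i=0..<k. (real q ^ n - real q ^ i) / (real q ^ k - real q ^ i)) / real q ^ (r * k)"
    by (subst prod.distrib) (simp add: power_mult power_one_over)
  finally show ?thesis by (simp add: gbinom_def)
qed

text \<open>Double counting of the pairs (C, v) with v in C - U. The family \<open>F\<close> is left
  arbitrary because it serves twice: for all subspaces, where it yields an exact recursion, and for
  the invariant ones, where it yields an upper bound.\<close>

lemma count_incidences:
  fixes U V :: "'v set"
  assumes "finite V" "U \<subseteq> V" and F: "\<And>C. C \<in> F \<Longrightarrow> C \<subseteq> V \<and> card C = N"
  shows "card {C \<in> F. U \<subseteq> C} * (N - card U) = (\<Sum>v\<in>V - U. card {C \<in> F. U \<subseteq> C \<and> v \<in> C})"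
proof -
  let ?F = "{C \<in> F. U \<subseteq> C}"
  have "finite F" using F \<open>finite V\<close> by (intro finite_subset[of F "Pow V"]) auto
  have finU: "finite U" using assms by (meson finite_subset)
  have "(\<Sum>v\<in>V - U. card {C \<in> F. U \<subseteq> C \<and> v \<in> C}) = (\<Sum>v\<in>V - U. \<Sum>C\<in>?F. if v \<in> C then 1 else 0)"
    using \<open>finite F\<close> by (intro sum.cong) (auto simp flip: sum.inter_filter intro!: arg_cong[where f = card])
  also have "\<dots> = (\<Sum>C\<in>?F. \<Sum>v\<in>V - U. if v \<in> C then 1 else 0)"
    by (rule sum.swap)
  also have "\<dots> = (\<Sum>C\<in>?F. N - card U)"
  proof (rule sum.cong)
    fix C assume C: "C \<in> ?F"
    have "(\<Sum>v\<in>V - U. if v \<in> C then 1 else 0) = card {v \<in> V - U. v \<in> C}"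
      using assms(1) by (simp flip: sum.inter_filter)
    also have "{v \<in> V - U. v \<in> C} = C - U"
      using C F by auto
    also have "card \<dots> = N - card U"
      using C F finU by (subst card_Diff_subset) auto
    finally show "(\<Sum>v\<in>V - U. if v \<in> C then 1 else 0) = N - card U" .
  qed simp
  finally show ?thesis by simp
qed

context finite_field_space begin

definition subspaces_of :: "'v set \<Rightarrow> nat \<Rightarrow> 'v set set" where
  "subspaces_of V k = {C. subspace C \<and> C \<subseteq> V \<and> card C = CARD('a) ^ k}"

lemma finite_subspaces_of: "finite V \<Longrightarrow> finite (subspaces_of V k)"
  by (rule finite_subset[of _ "Pow V"]) (auto simp: subspaces_of_def)

lemma span_insert_le_iff:
  assumes "subspace C" "subspace U"
  shows "span (insert v U) \<subseteq> C \<longleftrightarrow> U \<subseteq> C \<and> v \<in> C"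
  using assms span_minimal[of "insert v U" C] span_superset[of "insert v U"] by auto

text \<open>The double count expresses dimension \<open>u\<close> through \<open>u + 1\<close>, so
  the induction descends from \<open>u = k\<close>, where \<open>U\<close> itself is the only
  candidate.\<close>

lemma card_subspaces_containing:
  assumes V: "finite V" "subspace V" "card V = CARD('a) ^ n"
    and U: "subspace U" "U \<subseteq> V" "card U = CARD('a) ^ u" and "u \<le> k"
  shows "real (card {C \<in> subspaces_of V k. U \<subseteq> C}) = gbinom CARD('a) n k u"
  using \<open>u \<le> k\<close> U
proof (induction u arbitrary: U rule: inc_induct)
  case base
  have "C = U" if "C \<in> subspaces_of V k" "U \<subseteq> C" for C
    using that base V finite_subset[of C V]
    by (intro card_subset_eq[symmetric]) (auto simp: subspaces_of_def)
  then have "{C \<in> subspaces_of V k. U \<subseteq> C} = {U}"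
    using base by (auto simp: subspaces_of_def)
  then show ?case by (simp add: gbinom_def)
next
  case (step u)
  let ?q = "real CARD('a)"
  let ?S = "\<lambda>U. {C \<in> subspaces_of V k. U \<subseteq> C}"
  have q: "CARD('a) \<ge> 2" by (rule CARD_field_ge_2)
  have finU: "finite U" using step V finite_subset by blast
  have "real (card {C \<in> subspaces_of V k. U \<subseteq> C \<and> v \<in> C}) = gbinom CARD('a) n k (Suc u)"
    if "v \<in> V - U" for v
  proof -
    have "{C \<in> subspaces_of V k. U \<subseteq> C \<and> v \<in> C} = ?S (span (insert v U))"
      using span_insert_le_iff[OF _ step.prems(1)] by (auto simp: subspaces_of_def)
    moreover have "card (span (insert v U)) = CARD('a) ^ Suc u"
      using that card_span_insert[OF step.prems(1) finU, of v] step.prems by simp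
    moreover have "span (insert v U) \<subseteq> V"
      using that step.prems V by (intro span_minimal) auto
    ultimately show ?thesis using step.IH[of "span (insert v U)"] by simp
  qed
  then have sum: "real (\<Sum>v\<in>V - U. card {C \<in> subspaces_of V k. U \<subseteq> C \<and> v \<in> C})
      = real (card (V - U)) * gbinom CARD('a) n k (Suc u)"
    by simp
  have "u \<le> n"
    using card_mono[OF V(1) step.prems(2)] V step.prems q by (simp add: power_increasing_iff)
  then have card_diff: "real (card (V - U)) = ?q ^ n - ?q ^ u"
    using step.prems V finU q by (simp add: card_Diff_subset of_nat_diff power_increasing)
  have "card (?S U) * (CARD('a) ^ k - card U) = (\<Sum>v\<in>V - U. card {C \<in> subspaces_of V k. U \<subseteq> C \<and> v \<in> C})"
    using V step.prems by (intro count_incidences) (auto simp: subspaces_of_def)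
  then have "real (card (?S U)) * real (CARD('a) ^ k - card U) = (?q ^ n - ?q ^ u) * gbinom CARD('a) n k (Suc u)"
    unfolding sum[unfolded card_diff, symmetric] by (simp flip: of_nat_mult)
  also have "\<dots> = gbinom CARD('a) n k u * (?q ^ k - ?q ^ u)"
    using gbinom_rec[OF q, of u k n] step.hyps by simp
  also have "real (CARD('a) ^ k - card U) = ?q ^ k - ?q ^ u"
    using step q by (simp add: of_nat_diff power_increasing)
  finally show ?case using step.hyps q by simp
qed

lemma card_subspaces_of:
  assumes "finite V" "subspace V" "card V = CARD('a) ^ n"
  shows "real (card (subspaces_of V k)) = gbinom CARD('a) n k 0"
proof -
  have "{C \<in> subspaces_of V k. {0} \<subseteq> C} = subspaces_of V k"
    by (auto simp: subspaces_of_def subspace_0)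
  with card_subspaces_containing[of V n "{0}" 0 k] assms show ?thesis
    by (auto simp: subspace_0)
qed

end

section \<open>Eigenspaces of one linear map, and the subspaces invariant under a map of small
  rank\<close>

locale finite_field_endo = finite_field_space scale
  for scale :: "'a :: {finite, field} \<Rightarrow> 'v :: ab_group_add \<Rightarrow> 'v" (infixr \<open>*s\<close> 75) +
  fixes V :: "'v set" and n :: nat and T :: "'v \<Rightarrow> 'v"
  assumes finite_V: "finite V" and subspace_V: "subspace V" and card_V: "card V = CARD('a) ^ n"
    and T_add: "T (x + y) = T x + T y" and T_scale: "T (c *s x) = c *s T x"
    and T_closed: "x \<in> V \<Longrightarrow> T x \<in> V"
begin

definition invariant_subspaces :: "nat \<Rightarrow> 'v set set" where
  "invariant_subspaces k = {C \<in> subspaces_of V k. \<forall>x\<in>C. T x \<in> C}"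

definition eigenspace :: "'a \<Rightarrow> 'v set" where
  "eigenspace c = {x \<in> V. T x = c *s x}"

lemma T_diff: "T (x - y) = T x - T y"
  using T_add[of "x - y" y] by simp

lemma subspace_eigenspace: "subspace (eigenspace c)"
proof -
  have "T 0 = 0" using T_diff[of 0 0] by simp
  then show ?thesis
    using subspace_V unfolding subspace_def eigenspace_def
    by (auto simp: T_add T_scale scale_right_distrib mult.commute)
qed

lemma card_fiber:
  assumes "y \<in> V"
  shows "card {x \<in> V. T x - c *s x = T y - c *s y} = card (eigenspace c)"
proof -
  have "{x \<in> V. T x - c *s x = T y - c *s y} = (\<lambda>x. x + y) ` eigenspace c"
  proof (intro equalityI subsetI)
    fix x assume x: "x \<in> {x \<in> V. T x - c *s x = T y - c *s y}"
    then have "x - y \<in> eigenspace c"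
      using assms subspace_V
      by (auto simp: eigenspace_def T_diff subspace_diff scale_right_diff_distrib algebra_simps)
    then show "x \<in> (\<lambda>x. x + y) ` eigenspace c"
      by (intro image_eqI[of _ _ "x - y"]) auto
  qed (use assms subspace_V in \<open>auto simp: eigenspace_def T_add subspace_add scale_right_distrib\<close>)
  then show ?thesis by (simp add: card_image)
qed

lemma card_preimage_le:
  assumes "finite U"
  shows "card {x \<in> V. T x - c *s x \<in> U} \<le> card U * card (eigenspace c)"
proof -
  have "{x \<in> V. T x - c *s x \<in> U} = (\<Union>w\<in>U. {x \<in> V. T x - c *s x = w})" by auto
  also have "card \<dots> \<le> (\<Sum>w\<in>U. card {x \<in> V. T x - c *s x = w})"
    using assms by (rule card_UN_le)
  also have "\<dots> \<le> (\<Sum>w\<in>U. card (eigenspace c))"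
  proof (rule sum_mono)
    fix w
    show "card {x \<in> V. T x - c *s x = w} \<le> card (eigenspace c)"
    proof (cases "\<exists>y\<in>V. w = T y - c *s y")
      case True then show ?thesis using card_fiber by auto
    next
      case False then have "{x \<in> V. T x - c *s x = w} = {}" by auto
      then show ?thesis by (metis card.empty zero_le)
    qed
  qed
  finally show ?thesis by simp
qed

lemma card_image_eigenspace:
  "card ((\<lambda>x. T x - c *s x) ` V) * card (eigenspace c) = CARD('a) ^ n"
proof -
  have "card V = (\<Sum>w\<in>(\<lambda>x. T x - c *s x) ` V. card {x \<in> V. T x - c *s x = w})"
    using sum.image_gen[OF finite_V, of "\<lambda>_. 1::nat" "\<lambda>x. T x - c *s x"] by simp
  also have "\<dots> = (\<Sum>w\<in>(\<lambda>x. T x - c *s x) ` V. card (eigenspace c))"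
    by (rule sum.cong) (auto simp: card_fiber)
  finally show ?thesis using card_V by simp
qed

text \<open>The first summand is for \<open>C\<close> inside the eigenspace. Otherwise
  \<open>C\<close> contains some nonzero w = T x - c x; there are fewer than q^r such w, and each
  lies in a fraction of at most q^(k-n) of all candidates.\<close>

lemma card_invariant_le_small_rank:
  assumes e: "card (eigenspace c) = CARD('a) ^ (n - r)" and r: "r \<le> n" and k: "k \<le> n"
  shows "real (card (invariant_subspaces k)) \<le>
    gbinom CARD('a) n k 0 * (1 / real CARD('a) ^ (r * k) + real CARD('a) ^ r * real CARD('a) ^ k / real CARD('a) ^ n)"
proof (cases "k = 0")
  \<comment> \<open>The count of spaces through a given \<open>w\<close> needs
    \<open>k \<ge> 1\<close>. For \<open>k = 0\<close> the first summand is already 1.\<close>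
  case True
  have "card (invariant_subspaces k) \<le> card (subspaces_of V k)"
    using finite_subspaces_of[OF finite_V] by (intro card_mono) (auto simp: invariant_subspaces_def)
  then have "real (card (invariant_subspaces k)) \<le> gbinom CARD('a) n k 0"
    using card_subspaces_of[OF finite_V subspace_V card_V, of k] by linarith
  also have "\<dots> \<le> gbinom CARD('a) n k 0 * (1 / real CARD('a) ^ (r * k) + real CARD('a) ^ r * real CARD('a) ^ k / real CARD('a) ^ n)"
    using gbinom_nonneg[OF CARD_field_ge_2[where 'a = 'a] k, of 0] True
    by (simp add: mult_le_cancel_left1)
  finally show ?thesis .
next
  case False
  let ?q = "real CARD('a)"
  let ?I = "(\<lambda>x. T x - c *s x) ` V"
  let ?A = "subspaces_of (eigenspace c) k"
  let ?B = "\<lambda>w. {C \<in> subspaces_of V k. span {w} \<subseteq> C}"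
  have q: "CARD('a) \<ge> 2" by (rule CARD_field_ge_2)
  have finE: "finite (eigenspace c)" using finite_V by (simp add: eigenspace_def)
  have I: "real (card ?I) = ?q ^ r"
  proof -
    have "?q ^ n = ?q ^ r * ?q ^ (n - r)" using r by (simp flip: power_add)
    then have "real (card ?I) * ?q ^ (n - r) = ?q ^ r * ?q ^ (n - r)"
      using arg_cong[OF card_image_eigenspace[of c], of real] e by simp
    then show ?thesis using q by simp
  qed
  have "C \<in> ?A \<union> (\<Union>w\<in>?I - {0}. ?B w)" if C: "C \<in> invariant_subspaces k" for C
  proof (cases "C \<subseteq> eigenspace c")
    case True then show ?thesis using C by (auto simp: invariant_subspaces_def subspaces_of_def)
  next
    case False
    then obtain x where x: "x \<in> C" "x \<in> V" "T x \<noteq> c *s x"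
      using C by (auto simp: invariant_subspaces_def subspaces_of_def eigenspace_def)
    have sC: "subspace C" using C by (auto simp: invariant_subspaces_def subspaces_of_def)
    then have "T x - c *s x \<in> C"
      using C x by (auto simp: invariant_subspaces_def intro!: subspace_diff subspace_scale)
    then have "span {T x - c *s x} \<subseteq> C" using sC by (intro span_minimal) auto
    then show ?thesis using C x by (auto simp: invariant_subspaces_def)
  qed
  then have "invariant_subspaces k \<subseteq> ?A \<union> (\<Union>w\<in>?I - {0}. ?B w)" by blast
  then have "card (invariant_subspaces k) \<le> card (?A \<union> (\<Union>w\<in>?I - {0}. ?B w))"
    using finite_subspaces_of[OF finite_V] finite_subspaces_of[OF finE] finite_V
    by (intro card_mono) auto
  also have "\<dots> \<le> card ?A + (\<Sum>w\<in>?I - {0}. card (?B w))"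
    using finite_V by (intro order.trans[OF card_Un_le] add_left_mono card_UN_le) auto
  finally have 1: "real (card (invariant_subspaces k)) \<le> real (card ?A) + (\<Sum>w\<in>?I - {0}. real (card (?B w)))"
    by (simp flip: of_nat_sum of_nat_add)
  have 2: "real (card ?A) \<le> gbinom CARD('a) n k 0 / ?q ^ (r * k)"
  proof (cases "k \<le> n - r")
    case True
    then show ?thesis
      using card_subspaces_of[OF finE subspace_eigenspace e, of k] gbinom_shrink[OF q True r] by simp
  next
    case False
    have "?A = {}"
    proof (rule ccontr)
      assume "?A \<noteq> {}"
      then obtain C where "C \<subseteq> eigenspace c" "card C = CARD('a) ^ k"
        by (auto simp: subspaces_of_def)
      then have "CARD('a) ^ k \<le> CARD('a) ^ (n - r)" using e finE by (metis card_mono)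
      then show False using False q by (simp add: power_increasing_iff)
    qed
    then show ?thesis using gbinom_nonneg[OF q k, of 0] by simp
  qed
  have "(\<Sum>w\<in>?I - {0}. real (card (?B w))) = (\<Sum>w\<in>?I - {0}. gbinom CARD('a) n k 1)"
  proof (rule sum.cong)
    fix w assume w: "w \<in> ?I - {0}"
    then have "w \<in> V" using subspace_V T_closed by (auto intro!: subspace_diff subspace_scale)
    moreover have "card (span (insert w {0})) = CARD('a) ^ 1"
      using w card_span_insert[of "{0}" w] by simp
    moreover have "span {w} \<subseteq> V"
      using \<open>w \<in> V\<close> subspace_V by (intro span_minimal) auto
    ultimately show "real (card (?B w)) = gbinom CARD('a) n k 1"
      using \<open>k \<noteq> 0\<close> span_insert_0[of "{w}"]
      by (intro card_subspaces_containing[OF finite_V subspace_V card_V]) (auto simp: insert_commute)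
  qed simp
  also have "\<dots> \<le> ?q ^ r * gbinom CARD('a) n k 1"
  proof -
    have "card (?I - {0}) \<le> card ?I" using finite_V by (intro card_mono) auto
    then have "real (card (?I - {0})) \<le> ?q ^ r" unfolding I[symmetric] by simp
    then show ?thesis using gbinom_nonneg[OF q k, of 1] by (simp add: mult_right_mono)
  qed
  also have "gbinom CARD('a) n k 1 \<le> ?q ^ k * gbinom CARD('a) n k 0 / ?q ^ n"
    using gbinom_Suc_le[OF q k, of 0] q by (simp add: pos_le_divide_eq mult.commute)
  finally have 3: "(\<Sum>w\<in>?I - {0}. real (card (?B w))) \<le> ?q ^ r * (?q ^ k * gbinom CARD('a) n k 0 / ?q ^ n)"
    using q by (simp add: mult_left_mono)
  show ?thesis using 1 2 3 by (simp add: algebra_simps)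
qed

end

section \<open>Subspaces invariant under a map of large rank\<close>

text \<open>The arithmetic of one extension step, with x = q and \<open>G0\<close>,
  \<open>G1\<close>, \<open>G2\<close> the values of \<open>gbinom\<close> at u, u + 1, u + 2. Each
  of the two alternatives contributes at most x^(k-2) times the target \<open>D\<close>, and 2
  x^(k-2) \<le> x^(k-1) \<le> x^k - x^u because x \<ge> 2 and u < k.\<close>

lemma large_rank_step:
  fixes x G0 G1 G2 :: real
  assumes x: "x \<ge> 2" and nn: "G0 \<ge> 0"
    and G: "x ^ n * G1 \<le> x ^ k * G0" "x ^ n * G2 \<le> x ^ k * G1"
    and u: "u < j" "j \<le> k" and r: "g + j + 3 \<le> r" "r \<le> n" and g: "2 * g + 2 \<le> n - k"
  shows "x * (x ^ u * x ^ (n - r)) * (G1 / x ^ (g * (j - Suc u))) + x ^ n * (G2 / x ^ (g * (j - Suc (Suc u))))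
    \<le> (x ^ k - x ^ u) * (G0 / x ^ (g * (j - u)))"
proof -
  define D where "D = G0 / x ^ (g * (j - u))"
  have x0: "x > 0" and x1: "x \<ge> 1" using x by auto
  have D: "D \<ge> 0" using nn x0 by (simp add: D_def)
  \<comment> \<open>Only inequalities: for \<open>u = j - 1\<close> the truncated
    \<open>j - Suc (Suc u)\<close> is 0, so the second vector reaches beyond \<open>j\<close> and is
    not credited.\<close>
  have pow: "x ^ (g * (j - u)) \<le> x ^ g * x ^ (g * (j - Suc u))"
    "x ^ (g * (j - u)) \<le> x ^ (2 * g) * x ^ (g * (j - Suc (Suc u)))"
  proof -
    have "g * (j - u) \<le> g * (1 + (j - Suc u))" "g * (j - u) \<le> g * (2 + (j - Suc (Suc u)))"
      by (rule mult_le_mono2, simp)+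
    then show "x ^ (g * (j - u)) \<le> x ^ g * x ^ (g * (j - Suc u))"
      "x ^ (g * (j - u)) \<le> x ^ (2 * g) * x ^ (g * (j - Suc (Suc u)))"
      using x1 by (auto simp flip: power_add intro!: power_increasing simp: algebra_simps)
  qed
  have div: "G0 / b \<le> c * D" if "x ^ (g * (j - u)) \<le> c * b" "b > 0" for b c
  proof -
    have "G0 * x ^ (g * (j - u)) \<le> G0 * (c * b)" using that nn by (intro mult_left_mono)
    then show ?thesis using that x0 unfolding D_def by (simp add: field_simps)
  qed
  have G1: "G1 \<le> x ^ k / x ^ n * G0" using G(1) x0 by (simp add: field_simps)
  have "x ^ n * G2 \<le> x ^ k * (x ^ k / x ^ n * G0)"
    using G(2) mult_left_mono[OF G1, of "x ^ k"] x0 by (meson order_trans less_imp_le zero_less_power)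
  then have G2: "x ^ n * G2 \<le> x ^ k * x ^ k / x ^ n * G0" by simp
  have "x * (x ^ u * x ^ (n - r)) * (G1 / x ^ (g * (j - Suc u)))
      \<le> x * (x ^ u * x ^ (n - r)) * (x ^ k / x ^ n) * (G0 / x ^ (g * (j - Suc u)))"
    using mult_left_mono[OF G1, of "x * (x ^ u * x ^ (n - r)) / x ^ (g * (j - Suc u))"] x0
    by (simp add: mult_ac)
  also have "\<dots> \<le> x * (x ^ u * x ^ (n - r)) * (x ^ k / x ^ n) * (x ^ g * D)"
    using div[OF pow(1)] x0 by (intro mult_left_mono) auto
  also have "\<dots> = x ^ (1 + u + (n - r) + k + g) / x ^ n * D"
    by (simp add: power_add mult_ac)
  also have "\<dots> \<le> x ^ k / x ^ 2 * D"
  proof (intro mult_right_mono D)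
    \<comment> \<open>This is where the 3 in \<open>g + j + 3 \<le> r\<close> goes: one for the q
      scalars c, two for the spare factor x^2; \<open>u < j\<close> covers the rest.\<close>
    have "x ^ (1 + u + (n - r) + k + g + 2) \<le> x ^ (k + n)"
      using x1 u r by (intro power_increasing) auto
    then show "x ^ (1 + u + (n - r) + k + g) / x ^ n \<le> x ^ k / x ^ 2"
      using x0 by (simp add: pos_divide_le_eq pos_le_divide_eq power_add power2_eq_square mult_ac)
  qed
  finally have 1: "x * (x ^ u * x ^ (n - r)) * (G1 / x ^ (g * (j - Suc u))) \<le> x ^ k / x ^ 2 * D" .
  have "x ^ n * (G2 / x ^ (g * (j - Suc (Suc u)))) \<le> x ^ k * x ^ k / x ^ n * (G0 / x ^ (g * (j - Suc (Suc u))))"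
    using divide_right_mono[OF G2, of "x ^ (g * (j - Suc (Suc u)))"] x0 by simp
  also have "\<dots> \<le> x ^ k * x ^ k / x ^ n * (x ^ (2 * g) * D)"
    using div[OF pow(2)] x0 by (intro mult_left_mono) auto
  also have "\<dots> = x ^ (k + k + 2 * g) / x ^ n * D"
    by (simp only: power_add times_divide_eq_left times_divide_eq_right mult_ac)
  also have "\<dots> \<le> x ^ k / x ^ 2 * D"
  proof (intro mult_right_mono D)
    \<comment> \<open>Two new vectors save x^(2(n-k)) against x^n choices of v, leaving x^(n-k);
      \<open>2 * g + 2 \<le> n - k\<close> splits this into 2g for the credit and 2 spare.\<close>
    have "x ^ (k + k + 2 * g + 2) \<le> x ^ (k + n)"
      using x1 g by (intro power_increasing) auto
    then have "x ^ (k + k + 2 * g) * x ^ 2 \<le> x ^ k * x ^ n"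
      by (simp only: power_add)
    then show "x ^ (k + k + 2 * g) / x ^ n \<le> x ^ k / x ^ 2"
      using x0 by (simp add: pos_divide_le_eq pos_le_divide_eq)
  qed
  finally have 2: "x ^ n * (G2 / x ^ (g * (j - Suc (Suc u)))) \<le> x ^ k / x ^ 2 * D" .
  have "x ^ (u + 1) \<le> x ^ k"
    using u x1 by (intro power_increasing) auto
  then have xu: "x ^ u \<le> x ^ k / x" using x0 by (simp add: pos_le_divide_eq mult.commute)
  have "2 * (x ^ k / x) \<le> x * (x ^ k / x)" using x by (intro mult_right_mono) auto
  then have "2 * (x ^ k / x) \<le> x ^ k" using x0 by simp
  moreover have "2 * (x ^ k / x ^ 2) \<le> x * (x ^ k / x ^ 2)" using x by (intro mult_right_mono) auto
  then have "2 * (x ^ k / x ^ 2) \<le> x ^ k / x" using x0 by (simp add: power2_eq_square)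
  ultimately have le: "2 * (x ^ k / x ^ 2) * D \<le> (x ^ k - x ^ u) * D"
    using xu by (intro mult_right_mono D) linarith
  note add_mono[OF 1 2]
  also have "x ^ k / x ^ 2 * D + x ^ k / x ^ 2 * D = 2 * (x ^ k / x ^ 2) * D"
    by simp
  also note le
  finally show ?thesis unfolding D_def .
qed

context finite_field_endo begin

text \<open>If T v lies in the span of v and U, then T v - c v lies in U for some scalar c. The
  leading factor \<open>CARD('a)\<close> is the union over c.\<close>

lemma card_extension_not_closed_le:
  assumes U: "subspace U" "U \<subseteq> V" "card U = CARD('a) ^ u"
    and e: "\<And>c. card (eigenspace c) \<le> CARD('a) ^ (n - r)"
  shows "card {v \<in> V - U. T v \<in> span (insert v U)} \<le> CARD('a) * (CARD('a) ^ u * CARD('a) ^ (n - r))"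
proof -
  have finU: "finite U" using U finite_V finite_subset by blast
  have "v \<in> span U \<longleftrightarrow> v \<in> U" for v using U by (metis span_eq_iff)
  then have "{v \<in> V - U. T v \<in> span (insert v U)} \<subseteq> (\<Union>c. {v \<in> V. T v - c *s v \<in> U})"
    unfolding span_insert by auto
  then have "card {v \<in> V - U. T v \<in> span (insert v U)} \<le> card (\<Union>c. {v \<in> V. T v - c *s v \<in> U})"
    using finite_V by (intro card_mono) auto
  also have "\<dots> \<le> (\<Sum>c\<in>UNIV. card {v \<in> V. T v - c *s v \<in> U})"
    by (rule card_UN_le) simp
  also have "\<dots> \<le> (\<Sum>c\<in>(UNIV :: 'a set). CARD('a) ^ u * CARD('a) ^ (n - r))"
  proof (rule sum_mono)
    fix c :: 'a
    have "card {v \<in> V. T v - c *s v \<in> U} \<le> card U * card (eigenspace c)"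
      by (rule card_preimage_le[OF finU])
    also have "\<dots> \<le> CARD('a) ^ u * CARD('a) ^ (n - r)"
      using e[of c] U by simp
    finally show "card {v \<in> V. T v - c *s v \<in> U} \<le> CARD('a) ^ u * CARD('a) ^ (n - r)" .
  qed
  finally show ?thesis by simp
qed

text \<open>
  Adjoin to \<open>U\<close> a vector \<open>v\<close> of the invariant subspace. If \<open>T v \<notin> U + \<langle>v\<rangle>\<close>, then \<open>T v\<close> comes
  for free, which gains a factor \<open>q ^ (n - k)\<close>; otherwise \<open>v\<close> lies in one of the few
  preimages of \<open>U\<close> under some \<open>T - c\<close>, which gains a factor of about \<open>q ^ r\<close>.
\<close>
lemma card_invariant_containing_le:
  assumes e: "\<And>c. card (eigenspace c) \<le> CARD('a) ^ (n - r)"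
    and r: "g + j + 3 \<le> r" "r \<le> n" and g: "2 * g + 2 \<le> n - k" and k: "j \<le> k" "k \<le> n"
    and U: "subspace U" "U \<subseteq> V" "card U = CARD('a) ^ u"
  shows "real (card {C \<in> invariant_subspaces k. U \<subseteq> C}) \<le> gbinom CARD('a) n k u / real CARD('a) ^ (g * (j - u))"
  using U
\<comment> \<open>Strong induction, because one step raises the dimension by one or by two.\<close>
proof (induction "k - u" arbitrary: u U rule: less_induct)
  case less
  let ?q = "real CARD('a)"
  let ?N = "\<lambda>U. card {C \<in> invariant_subspaces k. U \<subseteq> C}"
  let ?A = "\<lambda>u. gbinom CARD('a) n k u / ?q ^ (g * (j - u))"
  note U = less.prems
  have q: "CARD('a) \<ge> 2" by (rule CARD_field_ge_2)
  have finU: "finite U" using U finite_V finite_subset by blast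
  have fin: "finite {C \<in> invariant_subspaces k. P C}" for P
    using finite_subspaces_of[OF finite_V, of k] by (auto simp: invariant_subspaces_def)
  consider "k < u" | "j \<le> u" "u \<le> k" | "u < j" using k by linarith
  then show ?case
  proof cases
    case 1
    have "\<not> U \<subseteq> C" if "C \<in> invariant_subspaces k" for C
    proof
      assume "U \<subseteq> C"
      moreover from that have "finite C" "card C = CARD('a) ^ k"
        using finite_V finite_subset by (auto simp: invariant_subspaces_def subspaces_of_def)
      ultimately have "CARD('a) ^ u \<le> CARD('a) ^ k" using U by (metis card_mono)
      then show False using 1 q by (simp add: power_increasing_iff)
    qed
    then have "{C \<in> invariant_subspaces k. U \<subseteq> C} = {}" by blast
    then have "?N U = 0" by (metis card.empty)
    then show ?thesis using gbinom_nonneg[OF q k(2), of u] by simp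
  next
    \<comment> \<open>From dimension \<open>j\<close> on, no saving is claimed, and invariance can
      be forgotten.\<close>
    case 2
    have "?N U \<le> card {C \<in> subspaces_of V k. U \<subseteq> C}"
      using finite_subspaces_of[OF finite_V, of k] by (intro card_mono) (auto simp: invariant_subspaces_def)
    then have "real (?N U) \<le> gbinom CARD('a) n k u"
      using card_subspaces_containing[OF finite_V subspace_V card_V U \<open>u \<le> k\<close>] by linarith
    then show ?thesis using 2 by simp
  next
    case 3
    define B where "B = {v \<in> V - U. T v \<in> span (insert v U)}"
    have ext: "span (insert v W) \<subseteq> V" "card (span (insert v W)) = CARD('a) ^ Suc w"
      if "v \<in> V - W" "subspace W" "W \<subseteq> V" "card W = CARD('a) ^ w" for v w W
    proof -
      show "span (insert v W) \<subseteq> V" using that subspace_V by (intro span_minimal) auto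
      have "finite W" using that finite_V finite_subset by blast
      then show "card (span (insert v W)) = CARD('a) ^ Suc w"
        using that card_span_insert(1)[of W v] by simp
    qed
    have N1: "real (card {C \<in> invariant_subspaces k. U \<subseteq> C \<and> v \<in> C}) \<le> ?A (Suc u)" if "v \<in> V - U" for v
    proof -
      have "{C \<in> invariant_subspaces k. U \<subseteq> C \<and> v \<in> C} = {C \<in> invariant_subspaces k. span (insert v U) \<subseteq> C}"
        using span_insert_le_iff[OF _ U(1)] by (auto simp: invariant_subspaces_def subspaces_of_def)
      then show ?thesis using less.hyps[of "Suc u" "span (insert v U)"] ext[OF that U] 3 k by simp
    qed
    have N2: "real (card {C \<in> invariant_subspaces k. U \<subseteq> C \<and> v \<in> C}) \<le> ?A (Suc (Suc u))" if "v \<in> V - U - B" for v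
    proof -
      let ?W = "span (insert v U)"
      have v: "v \<in> V - U" "T v \<in> V - ?W" using that T_closed by (auto simp: B_def)
      have "{C \<in> invariant_subspaces k. U \<subseteq> C \<and> v \<in> C} = {C \<in> invariant_subspaces k. span (insert (T v) ?W) \<subseteq> C}"
      proof (rule Collect_cong, rule conj_cong)
        fix C assume "C \<in> invariant_subspaces k"
        then have C: "subspace C" "\<And>x. x \<in> C \<Longrightarrow> T x \<in> C"
          by (auto simp: invariant_subspaces_def subspaces_of_def)
        show "U \<subseteq> C \<and> v \<in> C \<longleftrightarrow> span (insert (T v) ?W) \<subseteq> C"
          unfolding span_insert_le_iff[OF C(1) subspace_span] span_insert_le_iff[OF C(1) U(1)]
          using C(2) by blast
      qed simp
      then show ?thesis
        using less.hyps[of "Suc (Suc u)" "span (insert (T v) ?W)"] ext[OF v(1) U]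
          ext[OF v(2) subspace_span, of "Suc u"] 3 k by simp
    qed
    have A_nn: "?A w \<ge> 0" for w using gbinom_nonneg[OF q k(2), of w] by simp
    have "?N U * (CARD('a) ^ k - card U) = (\<Sum>v\<in>V - U. card {C \<in> invariant_subspaces k. U \<subseteq> C \<and> v \<in> C})"
      using U finite_V by (intro count_incidences) (auto simp: invariant_subspaces_def subspaces_of_def)
    then have "real (?N U) * real (CARD('a) ^ k - card U)
      = (\<Sum>v\<in>V - U. real (card {C \<in> invariant_subspaces k. U \<subseteq> C \<and> v \<in> C}))"
      by (simp flip: of_nat_mult of_nat_sum)
    also have "real (CARD('a) ^ k - card U) = ?q ^ k - ?q ^ u"
      using U q 3 k by (simp add: of_nat_diff power_increasing)
    also have "(\<Sum>v\<in>V - U. real (card {C \<in> invariant_subspaces k. U \<subseteq> C \<and> v \<in> C}))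
      = (\<Sum>v\<in>B. real (card {C \<in> invariant_subspaces k. U \<subseteq> C \<and> v \<in> C}))
        + (\<Sum>v\<in>V - U - B. real (card {C \<in> invariant_subspaces k. U \<subseteq> C \<and> v \<in> C}))"
      using finite_V by (subst sum.subset_diff[of B]) (auto simp: B_def)
    also have "\<dots> \<le> (\<Sum>v\<in>B. ?A (Suc u)) + (\<Sum>v\<in>V - U - B. ?A (Suc (Suc u)))"
      using N1 N2 by (intro add_mono sum_mono) (auto simp: B_def)
    also have "\<dots> = real (card B) * ?A (Suc u) + real (card (V - U - B)) * ?A (Suc (Suc u))"
      by simp
    also have "\<dots> \<le> (?q * (?q ^ u * ?q ^ (n - r))) * ?A (Suc u) + ?q ^ n * ?A (Suc (Suc u))"
    proof (intro add_mono mult_right_mono A_nn)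
      show "real (card B) \<le> ?q * (?q ^ u * ?q ^ (n - r))"
        using of_nat_mono[OF card_extension_not_closed_le[OF U e], where 'a = real] unfolding B_def
        by simp
      have "card (V - U - B) \<le> card V" using finite_V by (intro card_mono) auto
      then show "real (card (V - U - B)) \<le> ?q ^ n"
        using of_nat_mono[of "card (V - U - B)" "card V", where 'a = real] card_V by simp
    qed
    also have "\<dots> \<le> (?q ^ k - ?q ^ u) * ?A u"
      using q 3 k r g gbinom_nonneg[OF q k(2)] gbinom_Suc_le[OF q k(2)]
      by (intro large_rank_step) auto
    finally have "(?q ^ k - ?q ^ u) * real (?N U) \<le> (?q ^ k - ?q ^ u) * ?A u"
      by (simp add: mult.commute)
    moreover have "?q ^ k - ?q ^ u > 0" using q 3 k by simp
    ultimately show ?thesis by (rule mult_left_le_imp_le)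
  qed
qed

lemma card_invariant_le_large_rank:
  assumes "\<And>c. card (eigenspace c) \<le> CARD('a) ^ (n - r)"
    and "g + j + 3 \<le> r" "r \<le> n" "2 * g + 2 \<le> n - k" "j \<le> k" "k \<le> n"
  shows "real (card (invariant_subspaces k)) \<le> gbinom CARD('a) n k 0 / real CARD('a) ^ (g * j)"
proof -
  have "{C \<in> invariant_subspaces k. {0} \<subseteq> C} = invariant_subspaces k"
    by (auto simp: invariant_subspaces_def subspaces_of_def subspace_0)
  then show ?thesis
    using card_invariant_containing_le[OF assms, of "{0}" 0] subspace_0[OF subspace_V] by simp
qed

end

section \<open>Monomial maps\<close>

definition fun_scale :: "'a :: field \<Rightarrow> (nat \<Rightarrow> 'a) \<Rightarrow> nat \<Rightarrow> 'a" where
  "fun_scale c f = (\<lambda>i. c * f i)"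

text \<open>As functions vanishing from \<open>n\<close> on, the vectors of all lengths live in a
  single type with pointwise addition, as \<open>finite_field_space\<close> requires; length n
  becomes a finite subspace of it.\<close>

definition words :: "nat \<Rightarrow> (nat \<Rightarrow> 'a :: field) set" where
  "words n = {f. \<forall>i\<ge>n. f i = 0}"

text \<open>
  The pair \<open>(e, \<tau>)\<close> encodes the monomial matrix of the permutation \<open>\<tau>\<^sup>-\<^sup>1\<close> whose nonzero entry
  in column \<open>j\<close> is \<open>e j\<close>.
\<close>
definition mono_act :: "(nat \<Rightarrow> 'a :: field) \<times> (nat \<Rightarrow> nat) \<Rightarrow> (nat \<Rightarrow> 'a) \<Rightarrow> nat \<Rightarrow> 'a" where
  "mono_act = (\<lambda>(e, \<tau>) f j. e j * f (\<tau> j))"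

text \<open>Placing \<open>e\<close> in \<open>words n\<close> fixes its values beyond
  \<open>n\<close>, which makes the set finite and countable by its entries.\<close>

definition monomials :: "nat \<Rightarrow> ((nat \<Rightarrow> 'a :: field) \<times> (nat \<Rightarrow> nat)) set" where
  "monomials n = {(e, \<tau>). e \<in> words n \<and> (\<forall>j<n. e j \<noteq> 0) \<and> \<tau> permutes {..<n}}"

text \<open>The coordinates that the map merely multiplies by \<open>c\<close>. All of
  \<open>{..<n}\<close> means that the matrix is \<open>c\<close> times the identity.\<close>

definition scalar_on :: "nat \<Rightarrow> 'a :: field \<Rightarrow> (nat \<Rightarrow> 'a) \<times> (nat \<Rightarrow> nat) \<Rightarrow> nat set" where
  "scalar_on n c = (\<lambda>(e, \<tau>). {j. j < n \<and> \<tau> j = j \<and> e j = c})"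

global_interpretation word_space: finite_field_space "fun_scale :: 'a :: {finite, field} \<Rightarrow> _"
  by unfold_locales (auto simp: fun_scale_def fun_eq_iff algebra_simps)

lemma finite_words: "finite (words n :: (nat \<Rightarrow> 'a :: {finite, field}) set)"
  and card_words: "card (words n :: (nat \<Rightarrow> 'a :: {finite, field}) set) = CARD('a) ^ n"
proof -
  have "bij_betw (\<lambda>f. restrict f {..<n}) (words n :: (nat \<Rightarrow> 'a) set) ({..<n} \<rightarrow>\<^sub>E UNIV)"
    by (rule bij_betw_byWitness[where f' = "\<lambda>f i. if i < n then f i else 0"])
      (auto simp: words_def fun_eq_iff PiE_def extensional_def)
  then show "finite (words n :: (nat \<Rightarrow> 'a) set)" "card (words n :: (nat \<Rightarrow> 'a) set) = CARD('a) ^ n"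
    using bij_betw_finite bij_betw_same_card by (fastforce simp: card_PiE finite_PiE)+
qed

lemma card_le_determined:
  fixes E :: "(nat \<Rightarrow> 'a :: {finite, field}) set"
  assumes "finite A" and "\<And>f g. f \<in> E \<Longrightarrow> g \<in> E \<Longrightarrow> (\<forall>i\<in>A. f i = g i) \<Longrightarrow> f = g"
  shows "card E \<le> CARD('a) ^ card A"
proof -
  have "inj_on (\<lambda>f. restrict f A) E"
    using assms(2) by (intro inj_onI) (metis restrict_apply')
  then have "card E \<le> card (A \<rightarrow>\<^sub>E (UNIV :: 'a set))"
    using assms(1) by (intro card_inj_on_le[where f = "\<lambda>f. restrict f A"]) (auto intro: finite_PiE)
  then show ?thesis using assms(1) by (simp add: card_PiE)
qed

lemma subspace_words: "word_space.subspace (words n :: (nat \<Rightarrow> 'a :: {finite, field}) set)"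
  unfolding word_space.subspace_def by (auto simp: words_def fun_scale_def)

lemma finite_field_endo_mono_act:
  assumes "p \<in> monomials n"
  shows "finite_field_endo (fun_scale :: 'a :: {finite, field} \<Rightarrow> _) (words n) n (mono_act p)"
proof -
  obtain e \<tau> where p: "p = (e, \<tau>)" by (cases p)
  show ?thesis
  proof unfold_locales
    fix x :: "nat \<Rightarrow> 'a" assume "x \<in> words n"
    then show "mono_act p x \<in> words n"
      using assms by (auto simp: p mono_act_def words_def monomials_def)
  qed (auto simp: p mono_act_def fun_scale_def fun_eq_iff algebra_simps finite_words card_words subspace_words)
qed

text \<open>At i = \<open>inv_into UNIV \<tau> j\<close> the eigenvector equation reads e i * f j =
  c * f i, so f j is determined by a value of smaller \<mu>. At a fixed point with e j \<noteq> c it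
  forces f j = 0. Hence the values outside \<open>A\<close> determine f.\<close>

lemma card_eigenspace_le_descent:
  fixes \<mu> :: "nat \<Rightarrow> nat" and e :: "nat \<Rightarrow> 'a :: {finite, field}"
  assumes p: "(e, \<tau>) \<in> monomials n" and A: "A \<subseteq> {..<n}"
    and \<mu>: "\<And>j. j \<in> A \<Longrightarrow> \<tau> j = j \<and> e j \<noteq> c \<or> \<mu> (inv_into UNIV \<tau> j) < \<mu> j"
  shows "card {f \<in> words n. mono_act (e, \<tau>) f = fun_scale c f} \<le> CARD('a) ^ (n - card A)"
proof -
  have \<tau>: "\<tau> permutes {..<n}" and e: "\<And>j. j < n \<Longrightarrow> e j \<noteq> 0"
    using p by (auto simp: monomials_def)
  have "f = g" if f: "f \<in> words n" "mono_act (e, \<tau>) f = fun_scale c f"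
    and g: "g \<in> words n" "mono_act (e, \<tau>) g = fun_scale c g"
    and fg: "\<forall>i\<in>{..<n} - A. f i = g i" for f g
  proof
    fix j
    have f': "e i * f (\<tau> i) = c * f i" and g': "e i * g (\<tau> i) = c * g i" for i
      using f g by (auto simp: mono_act_def fun_scale_def fun_eq_iff)
    show "f j = g j"
    proof (induction j rule: measure_induct_rule[where f = \<mu>])
      case (less j)
      consider "n \<le> j" | "j \<in> {..<n} - A" | "j \<in> A" "\<tau> j = j" "e j \<noteq> c" | "j \<in> A" "\<mu> (inv_into UNIV \<tau> j) < \<mu> j"
        using \<mu>[of j] by force
      then show ?case
      proof cases
        case 3
        then show ?thesis using f'[of j] g'[of j] by simp
      next
        case 4
        have "inv_into UNIV \<tau> j < n" using 4 A permutes_in_image[OF permutes_inv[OF \<tau>], of j] by auto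
        moreover have "\<tau> (inv_into UNIV \<tau> j) = j" using \<tau> by (rule permutes_inverses)
        ultimately show ?thesis
          using less[OF 4(2)] f'[of "inv_into UNIV \<tau> j"] g'[of "inv_into UNIV \<tau> j"] e[of "inv_into UNIV \<tau> j"]
          by (metis mult_left_cancel)
      qed (use f g fg in \<open>auto simp: words_def\<close>)
    qed
  qed
  then have "card {f \<in> words n. mono_act (e, \<tau>) f = fun_scale c f} \<le> CARD('a) ^ card ({..<n} - A)"
    by (intro card_le_determined) auto
  also have "card ({..<n} - A) = n - card A"
    using A by (subst card_Diff_subset) (auto intro: finite_subset)
  finally show ?thesis .
qed

text \<open>
  An eigenvector is determined by its values outside the excedances of \<open>\<tau>\<close>, and likewise outside
  the anti-excedances; one of the two sets contains half of the moved points.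
\<close>
lemma card_nonscalar_points_le:
  fixes e :: "nat \<Rightarrow> 'a :: {finite, field}"
  assumes p: "(e, \<tau>) \<in> monomials n"
    and E: "card {f \<in> words n. mono_act (e, \<tau>) f = fun_scale c f} = CARD('a) ^ (n - r)" and r: "r \<le> n"
  shows "card ({..<n} - scalar_on n c (e, \<tau>)) \<le> 2 * r"
proof -
  define S where "S = {..<n} - scalar_on n c (e, \<tau>)"
  \<comment> \<open>A fixed point in \<open>S\<close> has e j \<noteq> c and may lie in both sets;
    the first alternative of the descent lemma covers it.\<close>
  define A1 where "A1 = {j \<in> S. inv_into UNIV \<tau> j \<le> j}"
  define A2 where "A2 = {j \<in> S. inv_into UNIV \<tau> j \<ge> j}"
  have \<tau>: "\<tau> permutes {..<n}" using p by (auto simp: monomials_def)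
  have fixed: "inv_into UNIV \<tau> j = j \<longleftrightarrow> \<tau> j = j" for j using \<tau> by (metis permutes_inverses)
  have lt: "inv_into UNIV \<tau> j < n" if "j < n" for j
    using that permutes_in_image[OF permutes_inv[OF \<tau>], of j] by auto
  have le: "card A \<le> r" if "A \<subseteq> {..<n}"
    "card {f \<in> words n. mono_act (e, \<tau>) f = fun_scale c f} \<le> CARD('a) ^ (n - card A)" for A
  proof -
    have "card A \<le> n" using card_mono[OF _ that(1)] by simp
    moreover have "n - r \<le> n - card A"
      using that(2) CARD_field_ge_2[where 'a = 'a] unfolding E by (simp add: power_increasing_iff)
    ultimately show ?thesis using r by simp
  qed
  have "card A1 \<le> r"
  proof (rule le)
    show A: "A1 \<subseteq> {..<n}" by (auto simp: A1_def S_def)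
    show "card {f \<in> words n. mono_act (e, \<tau>) f = fun_scale c f} \<le> CARD('a) ^ (n - card A1)"
      by (rule card_eigenspace_le_descent[OF p A, where \<mu> = "\<lambda>j. j"])
        (auto simp: A1_def S_def scalar_on_def fixed[symmetric] order.order_iff_strict)
  qed
  moreover have "card A2 \<le> r"
  proof (rule le)
    show A: "A2 \<subseteq> {..<n}" by (auto simp: A2_def S_def)
    show "card {f \<in> words n. mono_act (e, \<tau>) f = fun_scale c f} \<le> CARD('a) ^ (n - card A2)"
      \<comment> \<open>Reversing the order of the coordinates turns the ascent in \<open>A2\<close>
        into a descent.\<close>
      by (rule card_eigenspace_le_descent[OF p A, where \<mu> = "\<lambda>j. n - j"])
        (auto simp: A2_def S_def scalar_on_def fixed[symmetric] order.order_iff_strict lt diff_less_mono2)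
  qed
  moreover have "card S \<le> card A1 + card A2"
  proof -
    have "S = A1 \<union> A2" by (auto simp: A1_def A2_def)
    then show ?thesis by (metis card_Un_le)
  qed
  ultimately show ?thesis by (simp add: S_def)
qed

text \<open>Choose a set of points, permute it and pick its entries: (n choose t) * t! * q^t \<le>
  (n q)^t.\<close>

lemma card_monomials_few_nonscalar_points:
  fixes c :: "'a :: {finite, field}"
  assumes "t \<le> n"
  shows "card {p \<in> monomials n. card ({..<n} - scalar_on n c p) \<le> t} \<le> (CARD('a) * n) ^ t"
proof -
  let ?Q = "{S. S \<subseteq> {..<n} \<and> card S = t}"
  let ?E = "\<lambda>S. {e \<in> words n. \<forall>j<n. j \<notin> S \<longrightarrow> e j = c}"
  have "\<exists>S\<in>?Q. p \<in> ?E S \<times> {\<tau>. \<tau> permutes S}"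
    if p: "p \<in> monomials n" "card ({..<n} - scalar_on n c p) \<le> t" for p
  proof -
    obtain e \<tau> where et: "p = (e, \<tau>)" by (cases p)
    \<comment> \<open>Padding to exactly \<open>t\<close> points, possible as
      \<open>t \<le> n\<close>, avoids a sum over the sizes.\<close>
    obtain S where S: "{..<n} - scalar_on n c p \<subseteq> S" "S \<subseteq> {..<n}" "card S = t"
      using exists_subset_between[OF p(2), of "{..<n}"] assms by auto
    have "\<tau> permutes S"
      by (rule permutes_superset[of _ "{..<n}"]) (use S p et in \<open>auto simp: monomials_def scalar_on_def\<close>)
    with S p show ?thesis
      by (intro bexI[of _ S]) (auto simp: et monomials_def scalar_on_def)
  qed
  then have sub: "{p \<in> monomials n. card ({..<n} - scalar_on n c p) \<le> t} \<subseteq> (\<Union>S\<in>?Q. ?E S \<times> {\<tau>. \<tau> permutes S})"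
    by blast
  have finQ: "finite ?Q" by (rule finite_subset[of _ "Pow {..<n}"]) auto
  have finS: "finite S" if "S \<in> ?Q" for S using that finite_subset by auto
  have "finite (\<Union>S\<in>?Q. ?E S \<times> {\<tau>. \<tau> permutes S})"
    using finS by (intro finite_UN_I finQ finite_cartesian_product finite_permutations)
      (auto intro: finite_subset[OF _ finite_words[of n]])
  from card_mono[OF this sub]
  have "card {p \<in> monomials n. card ({..<n} - scalar_on n c p) \<le> t} \<le> card (\<Union>S\<in>?Q. ?E S \<times> {\<tau>. \<tau> permutes S})" .
  also have "\<dots> \<le> (\<Sum>S\<in>?Q. card (?E S \<times> {\<tau>. \<tau> permutes S}))"
    by (rule card_UN_le[OF finQ])
  also have "\<dots> \<le> (\<Sum>S\<in>?Q. CARD('a) ^ t * fact t)"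
  proof (rule sum_mono)
    fix S assume S: "S \<in> ?Q"
    have "card (?E S) \<le> CARD('a) ^ card S"
    proof (rule card_le_determined[OF finS[OF S]])
      fix f g assume fg: "f \<in> ?E S" "g \<in> ?E S" "\<forall>i\<in>S. f i = g i"
      have "f i = g i" for i
        using fg by (cases "i < n"; cases "i \<in> S") (auto simp: words_def)
      then show "f = g" by blast
    qed
    then show "card (?E S \<times> {\<tau>. \<tau> permutes S}) \<le> CARD('a) ^ t * fact t"
      using S finS[OF S] by (simp add: card_cartesian_product card_permutations)
  qed
  also have "\<dots> = (n choose t) * fact t * CARD('a) ^ t"
    by (simp add: n_subsets)
  also have "\<dots> \<le> n ^ t * CARD('a) ^ t"
    using binomial_fact_pow[of n t] by (intro mult_right_mono) auto
  finally show ?thesis by (simp add: power_mult_distrib mult.commute)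
qed

text \<open>The bad event of the union bound. Invariance is stated as closure, in the form of
  \<open>invariant_subspaces\<close>.\<close>

definition symmetric_codes :: "nat \<Rightarrow> nat \<Rightarrow> (nat \<Rightarrow> 'a :: {finite, field}) set set" where
  "symmetric_codes n k = {C \<in> word_space.subspaces_of (words n) k.
     \<exists>p\<in>monomials n. (\<forall>c. scalar_on n c p \<noteq> {..<n}) \<and> (\<forall>x\<in>C. mono_act p x \<in> C)}"

lemma finite_monomials: "finite (monomials n :: ((nat \<Rightarrow> 'a :: {finite, field}) \<times> (nat \<Rightarrow> nat)) set)"
  by (rule finite_subset[of _ "words n \<times> {\<tau>. \<tau> permutes {..<n}}"])
    (auto simp: monomials_def finite_words finite_permutations)

text \<open>The union bound with the per-map estimate \<open>P r\<close> kept abstract.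
  \<open>P\<close> may use both the exact size of one eigenspace and the bound on all of them, since
  the small-rank estimate needs the former and the large-rank estimate the latter. The factor q
  accounts for the choice of the eigenvalue.\<close>

lemma card_symmetric_codes_le:
  fixes P :: "nat \<Rightarrow> real" and n k :: nat
  defines "q \<equiv> CARD('a :: {finite, field})"
  defines "E \<equiv> \<lambda>p (c :: 'a). {f \<in> words n. mono_act p f = fun_scale c f}"
  assumes P: "\<And>p c r. p \<in> monomials n \<Longrightarrow> 1 \<le> r \<Longrightarrow> r \<le> n \<Longrightarrow> card (E p c) = q ^ (n - r) \<Longrightarrow>
      (\<And>c'. card (E p c') \<le> q ^ (n - r)) \<Longrightarrow>
      real (card {C \<in> word_space.subspaces_of (words n) k. \<forall>x\<in>C. mono_act p x \<in> C}) \<le> P r"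
    and P_nonneg: "\<And>r. P r \<ge> 0"
  shows "real (card (symmetric_codes n k :: (nat \<Rightarrow> 'a) set set))
    \<le> (\<Sum>r=1..n. real q * real (q * n) ^ min (2 * r) n * P r)"
proof -
  let ?I = "\<lambda>p. {C \<in> word_space.subspaces_of (words n :: (nat \<Rightarrow> 'a) set) k. \<forall>x\<in>C. mono_act p x \<in> C}"
  define K where "K r c = {p \<in> monomials n. card (E p c) = q ^ (n - r) \<and> (\<forall>c'. card (E p c') \<le> q ^ (n - r))}" for r c
  have q: "q \<ge> 2" unfolding q_def by (rule CARD_field_ge_2)
  have nonscalar: "card ({..<n} - scalar_on n c p) \<le> 2 * r"
    if "p \<in> monomials n" "card (E p c) = q ^ (n - r)" "r \<le> n" for p c r
    using that card_nonscalar_points_le[of "fst p" "snd p" n c r] by (simp add: E_def q_def)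
  have cardK: "card (K r c) \<le> (q * n) ^ min (2 * r) n" if "r \<le> n" for r c
  proof -
    have "K r c \<subseteq> {p \<in> monomials n. card ({..<n} - scalar_on n c p) \<le> min (2 * r) n}"
    proof
      fix p assume p: "p \<in> K r c"
      then have "card ({..<n} - scalar_on n c p) \<le> 2 * r"
        using nonscalar that by (auto simp: K_def)
      moreover have "card ({..<n} - scalar_on n c p) \<le> card {..<n}" by (rule card_mono) auto
      ultimately show "p \<in> {p \<in> monomials n. card ({..<n} - scalar_on n c p) \<le> min (2 * r) n}"
        using p by (simp add: K_def)
    qed
    then have "card (K r c) \<le> card {p \<in> monomials n. card ({..<n} - scalar_on n c p) \<le> min (2 * r) n}"
      by (intro card_mono finite_subset[OF _ finite_monomials[of n]]) auto
    also have "\<dots> \<le> (q * n) ^ min (2 * r) n"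
      unfolding q_def by (rule card_monomials_few_nonscalar_points) simp
    finally show ?thesis .
  qed
  have finI: "finite (?I p)" for p
    using word_space.finite_subspaces_of[OF finite_words[of n], of k] by (rule finite_subset[rotated]) auto
  have finK: "finite (K r c)" for r c
    by (rule finite_subset[OF _ finite_monomials[of n]]) (auto simp: K_def)
  have "C \<in> (\<Union>r\<in>{1..n}. \<Union>c. \<Union>p\<in>K r c. ?I p)" if sym: "C \<in> symmetric_codes n k" for C
  proof -
    obtain p where p: "p \<in> monomials n" "\<And>c. scalar_on n c p \<noteq> {..<n}" "\<forall>x\<in>C. mono_act p x \<in> C"
      and C: "C \<in> word_space.subspaces_of (words n) k"
      using sym unfolding symmetric_codes_def by blast
    interpret finite_field_endo "fun_scale :: 'a \<Rightarrow> _" "words n" n "mono_act p"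
      by (rule finite_field_endo_mono_act[OF p(1)])
    have E: "E p c = eigenspace c" for c by (auto simp: E_def eigenspace_def)
    \<comment> \<open>The largest eigenspace realises the minimal rank of T - c; a scalar c that is
      no eigenvalue is allowed and gives card 1.\<close>
    have "Max (range (\<lambda>c. card (E p c))) \<in> range (\<lambda>c. card (E p c))"
      by (rule Max_in) auto
    then obtain c where c: "card (E p c) = Max (range (\<lambda>c. card (E p c)))" by force
    have max: "card (E p c') \<le> card (E p c)" for c'
      unfolding c by (rule Max_ge) auto
    have finE: "finite (E p c)" using finite_V by (simp add: E_def)
    obtain d where d: "card (E p c) = q ^ d"
      using word_space.card_subspace[of "E p c"] subspace_eigenspace[of c] finE unfolding E q_def by metis
    have "card (E p c) \<le> card (words n :: (nat \<Rightarrow> 'a) set)"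
      using finite_V by (intro card_mono) (auto simp: E_def)
    then have "q ^ d \<le> q ^ n" using d card_V by (simp add: q_def)
    then have "d \<le> n" using q by (simp add: power_increasing_iff)
    \<comment> \<open>Rank 0 would leave no nonscalar coordinate, so the sum over r starts at
      1.\<close>
    have "d \<noteq> n"
    proof
      assume "d = n"
      then have "card ({..<n} - scalar_on n c p) \<le> 2 * 0"
        using d by (intro nonscalar p) auto
      then have "{..<n} \<subseteq> scalar_on n c p" by (simp add: Diff_eq_empty_iff)
      then have "scalar_on n c p = {..<n}" by (auto simp: scalar_on_def)
      then show False using p(2) by blast
    qed
    then have "n - d \<in> {1..n}" "n - (n - d) = d" using \<open>d \<le> n\<close> by auto
    moreover from this have "p \<in> K (n - d) c"
      using p(1) d max by (simp add: K_def)
    ultimately show ?thesis using C p(3) by blast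
  qed
  then have "symmetric_codes n k \<subseteq> (\<Union>r\<in>{1..n}. \<Union>c. \<Union>p\<in>K r c. ?I p)" by blast
  then have "card (symmetric_codes n k :: (nat \<Rightarrow> 'a) set set) \<le> card (\<Union>r\<in>{1..n}. \<Union>c. \<Union>p\<in>K r c. ?I p)"
    using finI finK by (intro card_mono finite_UN_I) auto
  also have "\<dots> \<le> (\<Sum>r=1..n. card (\<Union>c. \<Union>p\<in>K r c. ?I p))"
    by (rule card_UN_le) simp
  also have "\<dots> \<le> (\<Sum>r=1..n. \<Sum>c\<in>UNIV. card (\<Union>p\<in>K r c. ?I p))"
    by (intro sum_mono card_UN_le) simp
  also have "\<dots> \<le> (\<Sum>r=1..n. \<Sum>c\<in>UNIV. \<Sum>p\<in>K r c. card (?I p))"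
    by (intro sum_mono card_UN_le finK)
  finally have "real (card (symmetric_codes n k :: (nat \<Rightarrow> 'a) set set))
      \<le> (\<Sum>r=1..n. \<Sum>c\<in>UNIV. \<Sum>p\<in>K r c. real (card (?I p)))"
    by (simp flip: of_nat_sum)
  also have "\<dots> \<le> (\<Sum>r=1..n. \<Sum>c\<in>(UNIV :: 'a set). real (q * n) ^ min (2 * r) n * P r)"
  proof (intro sum_mono)
    fix r :: nat and c :: 'a assume r: "r \<in> {1..n}"
    have "(\<Sum>p\<in>K r c. real (card (?I p))) \<le> (\<Sum>p\<in>K r c. P r)"
      using r by (intro sum_mono P) (auto simp: K_def)
    also have "\<dots> = real (card (K r c)) * P r" by simp
    also have "\<dots> \<le> real ((q * n) ^ min (2 * r) n) * P r"
      using cardK[of r c] r by (intro mult_right_mono P_nonneg of_nat_mono) auto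
    finally show "(\<Sum>p\<in>K r c. real (card (?I p))) \<le> real (q * n) ^ min (2 * r) n * P r" by simp
  qed
  also have "\<dots> = (\<Sum>r=1..n. real q * real (q * n) ^ min (2 * r) n * P r)"
    by (simp add: q_def mult.assoc)
  finally show ?thesis .
qed

section \<open>Duality\<close>

definition pairing :: "nat \<Rightarrow> (nat \<Rightarrow> 'a :: field) \<Rightarrow> (nat \<Rightarrow> 'a) \<Rightarrow> 'a" where
  "pairing n x y = (\<Sum>i<n. x i * y i)"

definition dual_code :: "nat \<Rightarrow> (nat \<Rightarrow> 'a :: field) set \<Rightarrow> (nat \<Rightarrow> 'a) set" where
  "dual_code n C = {y \<in> words n. \<forall>x\<in>C. pairing n x y = 0}"

lemma pairing_linear:
  "pairing n (x + x') y = pairing n x y + pairing n x' y"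
  "pairing n x (y + y') = pairing n x y + pairing n x y'"
  "pairing n (x - x') y = pairing n x y - pairing n x' y"
  "pairing n x (y - y') = pairing n x y - pairing n x y'"
  "pairing n (fun_scale c x) y = c * pairing n x y"
  "pairing n x (fun_scale c y) = c * pairing n x y"
  "pairing n 0 y = 0" "pairing n x 0 = 0"
  by (simp_all add: pairing_def fun_scale_def sum.distrib sum_subtractf sum_distrib_left algebra_simps)

lemma pairing_commute: "pairing n x y = pairing n y x"
  by (simp add: pairing_def mult.commute)

lemma subspace_dual_code: "word_space.subspace (dual_code n (C :: (nat \<Rightarrow> 'a :: {finite, field}) set))"
proof -
  have "(0 :: nat \<Rightarrow> 'a) \<in> words n" "\<And>x y :: nat \<Rightarrow> 'a. x \<in> words n \<Longrightarrow> y \<in> words n \<Longrightarrow> x + y \<in> words n"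
    "\<And>c (x :: nat \<Rightarrow> 'a). x \<in> words n \<Longrightarrow> fun_scale c x \<in> words n"
    using subspace_words[of n] unfolding word_space.subspace_def by auto
  then show ?thesis
    unfolding word_space.subspace_def dual_code_def by (auto simp: pairing_linear)
qed

lemma finite_dual_code: "finite (dual_code n (C :: (nat \<Rightarrow> 'a :: {finite, field}) set))"
  using finite_words[of n] by (auto simp: dual_code_def)

text \<open>Sort the dual of \<open>U\<close> by the pairing with \<open>v\<close>: each of the q
  classes is empty or has a translate inside the dual of the larger space.\<close>

lemma card_dual_code_insert_le:
  fixes U :: "(nat \<Rightarrow> 'a :: {finite, field}) set"
  assumes "word_space.subspace U"
  shows "card (dual_code n U) \<le> CARD('a) * card (dual_code n (word_space.span (insert v U)))"
proof -
  let ?W = "word_space.span (insert v U)"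
  have in_W: "y \<in> dual_code n ?W" if y: "y \<in> dual_code n U" "pairing n v y = 0" for y
  proof -
    have "pairing n x y = 0" if xW: "x \<in> ?W" for x
    proof -
      obtain k where "x - fun_scale k v \<in> word_space.span U"
        using xW word_space.span_breakdown_eq by blast
      moreover have "word_space.span U = U" using assms by simp
      ultimately have "x - fun_scale k v \<in> U" by simp
      then have "pairing n (x - fun_scale k v) y = 0" using y by (auto simp: dual_code_def)
      then show ?thesis using y by (simp add: pairing_linear)
    qed
    then show ?thesis using y by (auto simp: dual_code_def)
  qed
  have "card (dual_code n U) = card (\<Union>c. {y \<in> dual_code n U. pairing n v y = c})"
    by (rule arg_cong[where f = card]) auto
  also have "\<dots> \<le> (\<Sum>c\<in>UNIV. card {y \<in> dual_code n U. pairing n v y = c})"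
    by (rule card_UN_le) simp
  also have "\<dots> \<le> (\<Sum>c\<in>(UNIV :: 'a set). card (dual_code n ?W))"
  proof (rule sum_mono)
    fix c :: 'a
    show "card {y \<in> dual_code n U. pairing n v y = c} \<le> card (dual_code n ?W)"
    proof (cases "{y \<in> dual_code n U. pairing n v y = c} = {}")
      case False
      then obtain z where z: "z \<in> dual_code n U" "pairing n v z = c" by auto
      show ?thesis
      proof (rule card_inj_on_le[where f = "\<lambda>y. y - z"])
        show "(\<lambda>y. y - z) ` {y \<in> dual_code n U. pairing n v y = c} \<subseteq> dual_code n ?W"
          using z word_space.subspace_diff[OF subspace_dual_code]
          by (auto intro!: in_W simp: pairing_linear)
      qed (auto simp: finite_dual_code inj_on_def)
    qed (metis card.empty zero_le)
  qed
  finally show ?thesis by simp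
qed

text \<open>Adjoining a vector multiplies \<open>card U\<close> by q and divides the size of the
  dual by at most q.\<close>

lemma card_dual_code_mono:
  fixes U W :: "(nat \<Rightarrow> 'a :: {finite, field}) set"
  assumes "word_space.subspace U" "word_space.subspace W" "U \<subseteq> W" "W \<subseteq> words n"
  shows "card (dual_code n U) * card U \<le> card (dual_code n W) * card W"
  using assms
proof (induction "card (W - U)" arbitrary: U rule: less_induct)
  case less
  have finW: "finite W" using less.prems finite_words finite_subset by blast
  then have finU: "finite U" using less.prems finite_subset by blast
  show ?case
  proof (cases "W \<subseteq> U")
    case False
    then obtain v where v: "v \<in> W" "v \<notin> U" by blast
    let ?U = "word_space.span (insert v U)"
    have sub: "?U \<subseteq> W" using less.prems v by (intro word_space.span_minimal) auto
    have sup: "insert v U \<subseteq> ?U" by (rule word_space.span_superset)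
    have "card (W - ?U) < card (W - U)"
      using finW v sup by (intro psubset_card_mono) auto
    then have IH: "card (dual_code n ?U) * card ?U \<le> card (dual_code n W) * card W"
      using less.prems sub by (intro less.hyps) auto
    have "card ?U = CARD('a) * card U"
      by (rule word_space.card_span_insert) (use less.prems finU v in auto)
    moreover have "card (dual_code n U) * card U \<le> CARD('a) * card (dual_code n ?U) * card U"
      using card_dual_code_insert_le[OF less.prems(1)] by (rule mult_right_mono) simp
    ultimately have "card (dual_code n U) * card U \<le> card (dual_code n ?U) * card ?U"
      by (simp only: mult_ac)
    then show ?thesis using IH by (rule order_trans)
  qed (use less.prems in \<open>auto dest: antisym\<close>)
qed

text \<open>
  The product \<open>card (dual_code n U) * card U\<close> is monotone in \<open>U\<close> and equals \<open>q ^ n\<close> at both ends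
  of the chain from \<open>{0}\<close> to \<open>words n\<close>, so it is constant.
\<close>
lemma card_dual_code:
  fixes C :: "(nat \<Rightarrow> 'a :: {finite, field}) set"
  assumes "word_space.subspace C" "C \<subseteq> words n"
  shows "card (dual_code n C) * card C = CARD('a) ^ n"
proof (rule antisym)
  have "dual_code n (words n :: (nat \<Rightarrow> 'a) set) = {0}"
  proof (rule equalityI; rule subsetI)
    fix y :: "nat \<Rightarrow> 'a" assume y: "y \<in> dual_code n (words n)"
    have "y i = 0" for i
    proof (cases "i < n")
      case True
      let ?u = "\<lambda>j. if j = i then 1 else 0 :: 'a"
      have "?u \<in> words n" using True by (auto simp: words_def)
      then have "pairing n ?u y = 0" using y by (auto simp: dual_code_def)
      then show ?thesis using True by (simp add: pairing_def if_distrib[of "\<lambda>x. x * _"] sum.delta cong: if_cong)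
    qed (use y in \<open>auto simp: dual_code_def words_def\<close>)
    then show "y \<in> {0}" by auto
  qed (auto simp: dual_code_def pairing_linear words_def)
  then show "card (dual_code n C) * card C \<le> CARD('a) ^ n"
    using card_dual_code_mono[OF assms(1) subspace_words assms(2) subset_refl] by (simp add: card_words)
  have "dual_code n {0 :: nat \<Rightarrow> 'a} = words n" by (auto simp: dual_code_def pairing_linear)
  then show "CARD('a) ^ n \<le> card (dual_code n C) * card C"
    using card_dual_code_mono[of "{0}" C n] assms word_space.subspace_0[OF assms(1)] by (simp add: card_words)
qed

text \<open>\<open>C\<close> lies in its double dual, and counting twice shows that the sizes
  agree.\<close>

lemma dual_code_subspaces_of:
  fixes C :: "(nat \<Rightarrow> 'a :: {finite, field}) set"
  assumes C: "C \<in> word_space.subspaces_of (words n) k" and k: "k \<le> n"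
  shows "dual_code n C \<in> word_space.subspaces_of (words n) (n - k)" "dual_code n (dual_code n C) = C"
proof -
  have C': "word_space.subspace C" "C \<subseteq> words n" "card C = CARD('a) ^ k"
    using C by (auto simp: word_space.subspaces_of_def)
  have split: "CARD('a) ^ n = CARD('a) ^ (n - k) * CARD('a) ^ k"
    using k by (simp flip: power_add)
  have card: "card (dual_code n C) = CARD('a) ^ (n - k)"
    using card_dual_code[OF C'(1,2)] unfolding C' split by simp
  show "dual_code n C \<in> word_space.subspaces_of (words n) (n - k)"
    using card subspace_dual_code[of n C] by (auto simp: word_space.subspaces_of_def dual_code_def)
  have "dual_code n C \<subseteq> words n" by (auto simp: dual_code_def)
  then have "card (dual_code n (dual_code n C)) * CARD('a) ^ (n - k) = CARD('a) ^ k * CARD('a) ^ (n - k)"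
    using card_dual_code[OF subspace_dual_code] card split by (metis mult.commute)
  then have "card (dual_code n (dual_code n C)) = card C" using C' by simp
  moreover have "C \<subseteq> dual_code n (dual_code n C)"
    using C'(2) by (auto simp: dual_code_def) (metis pairing_commute)
  ultimately show "dual_code n (dual_code n C) = C"
    by (metis card_subset_eq finite_dual_code)
qed

text \<open>If a map preserves \<open>C\<close>, its inverse transpose preserves the dual.\<close>

lemma dual_code_symmetric_codes:
  fixes C :: "(nat \<Rightarrow> 'a :: {finite, field}) set"
  assumes C: "C \<in> symmetric_codes n k" and k: "k \<le> n"
  shows "dual_code n C \<in> symmetric_codes n (n - k)"
proof -
  obtain e \<tau> where p: "(e, \<tau>) \<in> monomials n" and ns: "\<And>c. scalar_on n c (e, \<tau>) \<noteq> {..<n}"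
    and inv: "\<And>x. x \<in> C \<Longrightarrow> mono_act (e, \<tau>) x \<in> C" and C': "C \<in> word_space.subspaces_of (words n) k"
    using C by (auto simp: symmetric_codes_def)
  interpret finite_field_endo "fun_scale :: 'a \<Rightarrow> _" "words n" n "mono_act (e, \<tau>)"
    by (rule finite_field_endo_mono_act[OF p])
  \<comment> \<open>The inverse transpose of a monomial matrix keeps the permutation and inverts the
    entries.\<close>
  let ?p = "(\<lambda>j. inverse (e j), \<tau>)"
  have e: "\<And>j. j < n \<Longrightarrow> e j \<noteq> 0" and \<tau>: "\<tau> permutes {..<n}" using p by (auto simp: monomials_def)
  have p': "?p \<in> monomials n" using p by (auto simp: monomials_def words_def)
  interpret dual: finite_field_endo "fun_scale :: 'a \<Rightarrow> _" "words n" n "mono_act ?p"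
    by (rule finite_field_endo_mono_act[OF p'])
  have adj: "pairing n (mono_act (e, \<tau>) x) (mono_act ?p y) = pairing n x y" for x y
  proof -
    have "pairing n (mono_act (e, \<tau>) x) (mono_act ?p y) = (\<Sum>j<n. x (\<tau> j) * y (\<tau> j))"
      unfolding pairing_def mono_act_def using e by (intro sum.cong) auto
    also have "\<dots> = pairing n x y"
      unfolding pairing_def using sum.permute[OF \<tau>, of "\<lambda>j. x j * y j"] by (simp add: o_def)
    finally show ?thesis .
  qed
  have "inj_on (mono_act (e, \<tau>)) C"
  proof (rule inj_onI)
    fix x y assume xy: "x \<in> C" "y \<in> C" and eq: "mono_act (e, \<tau>) x = mono_act (e, \<tau>) y"
    have xw: "x \<in> words n" "y \<in> words n" using xy C' by (auto simp: word_space.subspaces_of_def)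
    show "x = y"
    proof
      fix j
      show "x j = y j"
      proof (cases "j < n")
        case True
        then have lt: "inv_into UNIV \<tau> j < n" using permutes_in_image[OF permutes_inv[OF \<tau>], of j] by auto
        have "e (inv_into UNIV \<tau> j) * x j = e (inv_into UNIV \<tau> j) * y j"
          using fun_cong[OF eq, of "inv_into UNIV \<tau> j"] permutes_inverses(1)[OF \<tau>, of j]
          by (simp add: mono_act_def)
        then show ?thesis using e[OF lt] by simp
      qed (use xw in \<open>auto simp: words_def\<close>)
    qed
  qed
  moreover have "finite C" using C' finite_words finite_subset by (auto simp: word_space.subspaces_of_def)
  \<comment> \<open>Moving the map across the pairing needs every x in \<open>C\<close> to be an
    image from \<open>C\<close>; finiteness supplies this.\<close>
  ultimately have surj: "mono_act (e, \<tau>) ` C = C"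
    using inv by (intro endo_inj_surj) auto
  have "mono_act ?p y \<in> dual_code n C" if y: "y \<in> dual_code n C" for y
  proof -
    have "pairing n x (mono_act ?p y) = 0" if x: "x \<in> C" for x
    proof -
      obtain x0 where "x0 \<in> C" "x = mono_act (e, \<tau>) x0" using x surj by blast
      then show ?thesis using y by (auto simp: adj dual_code_def)
    qed
    then show ?thesis using y dual.T_closed[of y] by (auto simp: dual_code_def)
  qed
  moreover have "scalar_on n c ?p \<noteq> {..<n}" for c
  proof -
    have "scalar_on n c ?p = scalar_on n (inverse c) (e, \<tau>)"
      by (auto simp: scalar_on_def)
    then show ?thesis using ns by simp
  qed
  ultimately show ?thesis
    using p' dual_code_subspaces_of(1)[OF C' k] unfolding symmetric_codes_def by blast
qed

text \<open>The second inequality, used for \<open>k\<close> and for \<open>n - k\<close>, makes the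
  total counts equal, so a bound on the fraction of symmetric codes carries over from
  \<open>n - k\<close> to \<open>k\<close>.\<close>

lemma card_symmetric_codes_dual:
  assumes "k \<le> n"
  shows "card (symmetric_codes n k :: (nat \<Rightarrow> 'a :: {finite, field}) set set)
      \<le> card (symmetric_codes n (n - k) :: (nat \<Rightarrow> 'a) set set)"
    and "card (word_space.subspaces_of (words n :: (nat \<Rightarrow> 'a) set) (n - k))
      \<le> card (word_space.subspaces_of (words n :: (nat \<Rightarrow> 'a) set) k)"
proof -
  have inj: "inj_on (dual_code n) (word_space.subspaces_of (words n :: (nat \<Rightarrow> 'a) set) k)"
    if "k \<le> n" for k
    using dual_code_subspaces_of(2)[OF _ that] by (rule inj_on_inverseI)
  show "card (symmetric_codes n k :: (nat \<Rightarrow> 'a) set set) \<le> card (symmetric_codes n (n - k) :: (nat \<Rightarrow> 'a) set set)"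
  proof (rule card_inj_on_le[where f = "dual_code n"])
    show "inj_on (dual_code n) (symmetric_codes n k :: (nat \<Rightarrow> 'a) set set)"
      using inj[OF assms] by (rule inj_on_subset) (auto simp: symmetric_codes_def)
    show "finite (symmetric_codes n (n - k) :: (nat \<Rightarrow> 'a) set set)"
      using word_space.finite_subspaces_of[OF finite_words[of n], of "n - k"]
      by (rule finite_subset[rotated]) (auto simp: symmetric_codes_def)
  qed (use dual_code_symmetric_codes assms in auto)
  show "card (word_space.subspaces_of (words n :: (nat \<Rightarrow> 'a) set) (n - k))
      \<le> card (word_space.subspaces_of (words n :: (nat \<Rightarrow> 'a) set) k)"
    using inj[of "n - k"] dual_code_subspaces_of(1)[of _ n "n - k"] assms
      word_space.finite_subspaces_of[OF finite_words[of n], of k]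
    by (intro card_inj_on_le[where f = "dual_code n"]) auto
qed

section \<open>Codes as sets of functions\<close>

text \<open>Links \<open>dim\<close> to the cardinalities that stand for dimension in all the
  counting: coordinates in a basis are unique.\<close>

lemma card_eq_CARD_power_dim:
  fixes C :: "'a :: {finite, field} Matrix.vec set"
  assumes sub: "VectorSpace.subspace class_ring C (module_vec TYPE('a) n)" and fin: "finite C"
  shows "card C = CARD('a) ^ vectorspace.dim class_ring ((module_vec TYPE('a) n)\<lparr>carrier := C\<rparr>)"
proof -
  let ?V = "(module_vec TYPE('a) n)\<lparr>carrier := C\<rparr>"
  interpret big: vectorspace "class_ring :: 'a ring" "module_vec TYPE('a) n" by (rule vec_vs)
  interpret W: vectorspace "class_ring :: 'a ring" ?V by (rule big.subspace_is_vs[OF sub])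
  have car: "carrier ?V = C" by simp
  \<comment> \<open>The finite set \<open>C\<close> generates itself, which yields finite
    dimension.\<close>
  have "W.gen_set C"
    using W.in_own_span[of C] W.span_is_subset2[of C] car by auto
  then have "W.fin_dim" unfolding W.fin_dim_def using fin car by blast
  then obtain B where B: "finite B" "W.basis B" using W.finite_basis_exists by blast
  have BC: "B \<subseteq> C" using B(2) unfolding W.basis_def car by blast
  have unique: "\<exists>!a. a \<in> B \<rightarrow>\<^sub>E (UNIV :: 'a set) \<and> W.lincomb a B = v" if "v \<in> C" for v
    using W.basis_criterion[OF B(1)] BC B(2) that by auto
  have closed: "W.lincomb a B \<in> C" for a
    using W.lincomb_closed[of B a] BC by auto
  have "bij_betw (\<lambda>a. W.lincomb a B) (B \<rightarrow>\<^sub>E (UNIV :: 'a set)) C"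
    unfolding bij_betw_def inj_on_def
  proof (intro conjI ballI impI)
    fix a b assume "a \<in> B \<rightarrow>\<^sub>E (UNIV :: 'a set)" "b \<in> B \<rightarrow>\<^sub>E (UNIV :: 'a set)" "W.lincomb a B = W.lincomb b B"
    then show "a = b" using unique[OF closed[of b]] by blast
  next
    show "(\<lambda>a. W.lincomb a B) ` (B \<rightarrow>\<^sub>E (UNIV :: 'a set)) = C"
    proof (intro equalityI subsetI)
      fix v assume "v \<in> C"
      then obtain a where "a \<in> B \<rightarrow>\<^sub>E (UNIV :: 'a set)" "W.lincomb a B = v" using unique by blast
      then show "v \<in> (\<lambda>a. W.lincomb a B) ` (B \<rightarrow>\<^sub>E (UNIV :: 'a set))" by blast
    qed (use closed in auto)
  qed
  then have "card C = card (B \<rightarrow>\<^sub>E (UNIV :: 'a set))" by (simp add: bij_betw_same_card)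
  also have "\<dots> = CARD('a) ^ W.dim"
    using W.dim_basis[OF B] B(1) by (simp add: card_PiE)
  finally show ?thesis .
qed

definition word_of :: "nat \<Rightarrow> 'a :: field Matrix.vec \<Rightarrow> nat \<Rightarrow> 'a" where
  "word_of n v = (\<lambda>i. if i < n then v $ i else 0)"

lemma bij_betw_word_of: "bij_betw (word_of n) (carrier_vec n) (words n)"
  by (rule bij_betw_byWitness[where f' = "\<lambda>f. Matrix.vec n f"])
    (auto simp: word_of_def words_def fun_eq_iff)

lemma word_of_linear:
  "x \<in> carrier_vec n \<Longrightarrow> y \<in> carrier_vec n \<Longrightarrow> word_of n (x + y) = word_of n x + word_of n y"
  "x \<in> carrier_vec n \<Longrightarrow> word_of n (c \<cdot>\<^sub>v x) = fun_scale c (word_of n x)"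
  "word_of n (0\<^sub>v n) = 0"
  by (auto simp: word_of_def fun_scale_def fun_eq_iff)

lemma subspace_vec_iff:
  "VectorSpace.subspace class_ring C (module_vec TYPE('a :: field) n) \<longleftrightarrow>
     C \<subseteq> carrier_vec n \<and> 0\<^sub>v n \<in> C \<and> (\<forall>x\<in>C. \<forall>y\<in>C. x + y \<in> C) \<and> (\<forall>c. \<forall>x\<in>C. c \<cdot>\<^sub>v x \<in> C)"
  using vec_vs[where 'a = 'a, of n] vec_module[where 'a = 'a, of n]
  by (auto simp: VectorSpace.subspace_def LinearCombinations.submodule_def module_vec_simps)

lemma word_of_image_subspace:
  fixes C :: "'a :: {finite, field} Matrix.vec set"
  assumes "C \<subseteq> carrier_vec n"
  shows "word_space.subspace (word_of n ` C) \<longleftrightarrow> VectorSpace.subspace class_ring C (module_vec TYPE('a) n)"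
proof -
  have inj: "inj_on (word_of n :: 'a Matrix.vec \<Rightarrow> _) (carrier_vec n)"
    using bij_betw_word_of by (rule bij_betw_imp_inj_on)
  have mem: "word_of n x \<in> word_of n ` C \<longleftrightarrow> x \<in> C" if "x \<in> carrier_vec n" for x
    using inj assms that by (auto simp: inj_on_image_mem_iff)
  have "0 \<in> word_of n ` C \<longleftrightarrow> 0\<^sub>v n \<in> C"
    using mem[of "0\<^sub>v n"] by (simp add: word_of_linear)
  moreover have "word_of n x + word_of n y \<in> word_of n ` C \<longleftrightarrow> x + y \<in> C" if "x \<in> C" "y \<in> C" for x y
    using mem[of "x + y"] assms that by (simp add: word_of_linear subset_iff)
  moreover have "fun_scale c (word_of n x) \<in> word_of n ` C \<longleftrightarrow> c \<cdot>\<^sub>v x \<in> C" if "x \<in> C" for c x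
    using mem[of "c \<cdot>\<^sub>v x"] assms that by (simp add: word_of_linear subset_iff)
  ultimately show ?thesis
    unfolding word_space.subspace_def subspace_vec_iff using assms by auto
qed

lemma bij_betw_linear_codes:
  "bij_betw ((`) (word_of n)) (linear_codes n k :: 'a :: {finite, field} Matrix.vec set set)
    (word_space.subspaces_of (words n) k)"
proof -
  have bij: "bij_betw ((`) (word_of n)) (Pow (carrier_vec n)) (Pow (words n :: (nat \<Rightarrow> 'a) set))"
    using bij_betw_word_of by (rule bij_betw_Pow)
  have fin: "finite (carrier_vec n :: 'a Matrix.vec set)"
    using bij_betw_word_of finite_words bij_betw_finite by blast
  have iff: "C \<in> linear_codes n k \<longleftrightarrow> word_of n ` C \<in> word_space.subspaces_of (words n) k"
    if C: "C \<subseteq> carrier_vec n" for C :: "'a Matrix.vec set"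
  proof -
    have "card (word_of n ` C) = card C"
      using bij_betw_imp_inj_on[OF bij_betw_word_of] C by (metis card_image inj_on_subset)
    moreover have "word_of n ` C \<subseteq> words n"
      using bij_betw_word_of[where 'a = 'a, of n] C by (auto simp: bij_betw_def)
    moreover have "finite C" using C fin finite_subset by blast
    ultimately show ?thesis
      using card_eq_CARD_power_dim[of C n] CARD_field_ge_2[where 'a = 'a]
      by (auto simp: linear_codes_def word_space.subspaces_of_def word_of_image_subspace[OF C] power_inject_exp)
  qed
  have sub: "linear_codes n k \<subseteq> Pow (carrier_vec n :: 'a Matrix.vec set)"
    by (auto simp: linear_codes_def subspace_vec_iff)
  have "(`) (word_of n) ` (linear_codes n k :: 'a Matrix.vec set set) = word_space.subspaces_of (words n) k"
  proof (intro equalityI subsetI)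
    fix D :: "(nat \<Rightarrow> 'a) set" assume D: "D \<in> word_space.subspaces_of (words n) k"
    then have "D \<in> Pow (words n)" by (auto simp: word_space.subspaces_of_def)
    then have "D \<in> (`) (word_of n) ` Pow (carrier_vec n)"
      unfolding bij_betw_imp_surj_on[OF bij] .
    then obtain C where "C \<subseteq> carrier_vec n" "D = word_of n ` C" by (elim imageE) simp
    then show "D \<in> (`) (word_of n) ` linear_codes n k" using D iff by blast
  next
    fix D assume "D \<in> (`) (word_of n) ` (linear_codes n k :: 'a Matrix.vec set set)"
    then show "D \<in> word_space.subspaces_of (words n) k" using iff sub by blast
  qed
  then show ?thesis by (rule bij_betw_subset[OF bij sub])
qed

text \<open>Row i of the matrix is supported in column \<sigma> i, so column j is supported in row
  \<open>inv_into UNIV \<sigma> j\<close>; hence the inverse permutation on the right.\<close>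

lemma row_vec_mult_monomial:
  fixes x :: "'a :: field Matrix.vec"
  assumes \<sigma>: "\<sigma> permutes {..<n}" and x: "x \<in> carrier_vec n"
  shows "word_of n (row_vec_mult x (mat_diag n d * perm_matrix n \<sigma>)) =
    mono_act (\<lambda>j. if j < n then d (inv_into UNIV \<sigma> j) else 0, inv_into UNIV \<sigma>) (word_of n x)"
proof
  fix j
  show "word_of n (row_vec_mult x (mat_diag n d * perm_matrix n \<sigma>)) j =
    mono_act (\<lambda>j. if j < n then d (inv_into UNIV \<sigma> j) else 0, inv_into UNIV \<sigma>) (word_of n x) j"
  proof (cases "j < n")
    case True
    let ?i = "inv_into UNIV \<sigma> j"
    have i: "?i < n" using True permutes_in_image[OF permutes_inv[OF \<sigma>], of j] by auto
    have eq: "j = \<sigma> i \<longleftrightarrow> i = ?i" for i using permutes_inverses[OF \<sigma>] by metis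
    have "row_vec_mult x (mat_diag n d * perm_matrix n \<sigma>) $ j
      = (\<Sum>i<n. x $ i * (d i * (if j = \<sigma> i then 1 else 0)))"
      using True x by (simp add: row_vec_mult_def mat_diag_mult_left[of _ n n] perm_matrix_def
        scalar_prod_def lessThan_atLeast0)
    also have "\<dots> = (\<Sum>i<n. if i = ?i then x $ i * d i else 0)"
      unfolding eq by (intro sum.cong) auto
    also have "\<dots> = x $ ?i * d ?i" using i by simp
    finally show ?thesis using True i by (simp add: word_of_def mono_act_def)
  qed (simp add: word_of_def mono_act_def)
qed

lemma scalar_in_MAut:
  fixes C :: "'a :: field Matrix.vec set"
  assumes C: "VectorSpace.subspace class_ring C (module_vec TYPE('a) n)" and c: "c \<noteq> 0"
  shows "c \<cdot>\<^sub>m 1\<^sub>m n \<in> MAut n C"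
proof -
  have "c \<cdot>\<^sub>m 1\<^sub>m n = mat_diag n (\<lambda>_. c) * perm_matrix n id"
    by (rule eq_matI) (auto simp: mat_diag_mult_left[of _ n n] perm_matrix_def)
  then have "c \<cdot>\<^sub>m 1\<^sub>m n \<in> monomial_group n"
    using c unfolding monomial_group_def by (auto intro!: exI[of _ "\<lambda>_. c"] exI[of _ id] permutes_id)
  moreover have mult: "row_vec_mult x (c \<cdot>\<^sub>m 1\<^sub>m n) = c \<cdot>\<^sub>v x" if "x \<in> carrier_vec n" for x
    using that by (intro eq_vecI) (auto simp: row_vec_mult_def)
  moreover have "(\<lambda>x. row_vec_mult x (c \<cdot>\<^sub>m 1\<^sub>m n)) ` C = C"
  proof (intro equalityI subsetI)
    fix x assume x: "x \<in> C"
    then have "inverse c \<cdot>\<^sub>v x \<in> C" "inverse c \<cdot>\<^sub>v x \<in> carrier_vec n" "x \<in> carrier_vec n"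
      using C unfolding subspace_vec_iff by auto
    then show "x \<in> (\<lambda>x. row_vec_mult x (c \<cdot>\<^sub>m 1\<^sub>m n)) ` C"
      using c mult by (intro image_eqI[of _ _ "inverse c \<cdot>\<^sub>v x"]) (auto simp: smult_smult_assoc)
  qed (use C mult in \<open>auto simp: subspace_vec_iff subset_iff\<close>)
  ultimately show ?thesis by (simp add: MAut_def)
qed

lemma nontrivial_MAut_imp_symmetric_codes:
  fixes C :: "'a :: {finite, field} Matrix.vec set"
  assumes C: "C \<in> linear_codes n k" and nontriv: "MAut n C \<noteq> MAut0 n" and n: "n > 0"
  shows "word_of n ` C \<in> symmetric_codes n k"
proof -
  have sub: "VectorSpace.subspace class_ring C (module_vec TYPE('a) n)"
    using C by (simp add: linear_codes_def)
  then have car: "C \<subseteq> carrier_vec n" by (simp add: subspace_vec_iff)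
  have "MAut0 n \<subseteq> MAut n C"
    using scalar_in_MAut[OF sub] by (auto simp: MAut0_def)
  then obtain M where M: "M \<in> MAut n C" "M \<notin> MAut0 n" using nontriv by blast
  then obtain d \<sigma> where Meq: "M = mat_diag n d * perm_matrix n \<sigma>" and d: "\<And>i. i < n \<Longrightarrow> d i \<noteq> 0"
    and \<sigma>: "\<sigma> permutes {..<n}"
    unfolding MAut_def monomial_group_def by blast
  let ?p = "(\<lambda>j. if j < n then d (inv_into UNIV \<sigma> j) else 0, inv_into UNIV \<sigma>)"
  have lt: "inv_into UNIV \<sigma> j < n" if "j < n" for j
    using that permutes_in_image[OF permutes_inv[OF \<sigma>], of j] by auto
  have "?p \<in> monomials n"
    using d lt permutes_inv[OF \<sigma>] by (auto simp: monomials_def words_def)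
  moreover have "scalar_on n c ?p \<noteq> {..<n}" for c
  proof
    assume eq: "scalar_on n c ?p = {..<n}"
    have j: "inv_into UNIV \<sigma> j = j \<and> d j = c" if "j < n" for j
    proof -
      have "j \<in> scalar_on n c ?p" using eq that by simp
      then show ?thesis using that by (auto simp: scalar_on_def)
    qed
    then have "\<sigma> j = j" if "j < n" for j using that permutes_inverses(1)[OF \<sigma>, of j] by simp
    then have "M = c \<cdot>\<^sub>m 1\<^sub>m n"
      unfolding Meq using j
      by (intro eq_matI) (auto simp: mat_diag_mult_left[of _ n n] perm_matrix_def)
    \<comment> \<open>Coordinate 0 exists because \<open>n > 0\<close>, and its entry equals
      c.\<close>
    moreover have "c \<noteq> 0" using j[of 0] d[of 0] n by auto
    ultimately show False using M(2) by (auto simp: MAut0_def)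
  qed
  moreover have "mono_act ?p y \<in> word_of n ` C" if y: "y \<in> word_of n ` C" for y
  proof -
    obtain x where x: "x \<in> C" "y = word_of n x" using y by blast
    then have "row_vec_mult x M \<in> C" using M(1) by (auto simp: MAut_def)
    then show ?thesis
      using row_vec_mult_monomial[OF \<sigma>, of x d] x car Meq by (metis image_eqI subsetD)
  qed
  moreover have "word_of n ` C \<in> word_space.subspaces_of (words n) k"
    using bij_betwE[OF bij_betw_linear_codes] C by blast
  ultimately show ?thesis unfolding symmetric_codes_def by blast
qed

lemma prob_trivial_MAut_ge:
  assumes "n > 0" "k \<le> n"
  shows "measure_pmf.prob (random_code n k :: 'a :: {finite, field} Matrix.vec set pmf) {C. MAut n C = MAut0 n}
    \<ge> 1 - real (card (symmetric_codes n k :: (nat \<Rightarrow> 'a) set set)) /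
        real (card (word_space.subspaces_of (words n :: (nat \<Rightarrow> 'a) set) k))"
proof -
  let ?L = "linear_codes n k :: 'a Matrix.vec set set"
  let ?T = "{C :: 'a Matrix.vec set. MAut n C = MAut0 n}"
  let ?S = "word_space.subspaces_of (words n :: (nat \<Rightarrow> 'a) set) k"
  have cardL: "card ?L = card ?S"
    using bij_betw_linear_codes by (rule bij_betw_same_card)
  have "real (card ?S) = gbinom CARD('a) n k 0"
    using word_space.card_subspaces_of[OF finite_words subspace_words card_words] .
  \<comment> \<open>\<open>pmf_of_set\<close> is the uniform distribution only on a finite nonempty
    set.\<close>
  then have "card ?L > 0"
    using gbinom_pos[OF CARD_field_ge_2[where 'a = 'a] assms(2), of 0] cardL by simp
  then have L: "finite ?L" "?L \<noteq> {}"
    by (simp add: card_ge_0_finite, metis card.empty less_irrefl)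
  have "card (?L \<inter> - ?T) \<le> card (symmetric_codes n k :: (nat \<Rightarrow> 'a) set set)"
  proof (rule card_inj_on_le[where f = "(`) (word_of n)"])
    show "inj_on ((`) (word_of n)) (?L \<inter> - ?T)"
      using bij_betw_imp_inj_on[OF bij_betw_linear_codes] by (rule inj_on_subset) auto
    show "(`) (word_of n) ` (?L \<inter> - ?T) \<subseteq> symmetric_codes n k"
      using nontrivial_MAut_imp_symmetric_codes assms by auto
    show "finite (symmetric_codes n k :: (nat \<Rightarrow> 'a) set set)"
      using word_space.finite_subspaces_of[OF finite_words[of n], of k]
      by (rule finite_subset[rotated]) (auto simp: symmetric_codes_def)
  qed
  then have "measure_pmf.prob (random_code n k) (- ?T)
      \<le> real (card (symmetric_codes n k :: (nat \<Rightarrow> 'a) set set)) / real (card ?S)"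
    unfolding random_code_def using L by (simp add: measure_pmf_of_set cardL divide_right_mono)
  then show ?thesis
    using measure_pmf.prob_compl[of ?T "random_code n k"] by (simp add: Compl_eq_Diff_UNIV)
qed

section \<open>Asymptotics\<close>

lemma sum_power_le_double:
  fixes x :: real
  assumes "0 \<le> x" "x \<le> 1 / 2"
  shows "(\<Sum>r=1..R. x ^ r) \<le> 2 * x"
proof -
  let ?s = "\<Sum>r=1..R. x ^ r"
  have "(1 - x) * ?s = x - x ^ Suc R"
  proof (induction R)
    case (Suc R)
    have "(1 - x) * (\<Sum>r=1..Suc R. x ^ r) = (1 - x) * (\<Sum>r=1..R. x ^ r) + (1 - x) * x ^ Suc R"
      by (simp add: distrib_left)
    also have "\<dots> = x - x ^ Suc (Suc R)" unfolding Suc by (simp add: algebra_simps)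
    finally show ?case .
  qed simp
  moreover have "x ^ Suc R \<ge> 0" using assms by simp
  ultimately have "(1 - x) * ?s \<le> x" by linarith
  moreover have "(1 / 2) * ?s \<le> (1 - x) * ?s"
    using assms by (intro mult_right_mono sum_nonneg) auto
  ultimately show ?thesis by linarith
qed

text \<open>The bound on the fraction of codes invariant under one map of rank parameter
  \<open>r\<close>, with threshold \<open>R\<close>. The minimum is the largest \<open>g\<close>
  satisfying both \<open>g + j + 3 \<le> r\<close> and \<open>2 * g + 2 \<le> n - k\<close>.\<close>

definition union_term :: "nat \<Rightarrow> nat \<Rightarrow> nat \<Rightarrow> nat \<Rightarrow> nat \<Rightarrow> nat \<Rightarrow> real" where
  "union_term q n k j R r = (if r \<le> R then 1 / real q ^ (r * k) + real q ^ r * real q ^ k / real q ^ n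
     else 1 / real q ^ (min (r - j - 3) ((n - k - 2) div 2) * j))"

text \<open>Since q^k \<ge> n^(2+\<epsilon>), the ratio (q n)^2 / q^k is at most q^2
  n^(-\<epsilon>), and the eigenspace terms form a geometric series. Each of the at most sqrt n
  image terms is bounded by \<open>B\<close>, where \<open>2 * k \<le> n\<close> provides the decay
  q^(-n/2).\<close>

lemma small_rank_sum_le:
  fixes q n k R :: nat and \<epsilon> :: real
  assumes q: "q \<ge> 2" and n: "n \<ge> 1" and k: "2 * k \<le> n" "(2 + \<epsilon>) * log q n \<le> k"
    and R: "real R \<le> sqrt n" and x: "real q ^ 2 * n powr (- \<epsilon>) \<le> 1 / 2"
  shows "(\<Sum>r=1..R. q * real (q * n) ^ min (2 * r) n * (1 / real q ^ (r * k) + real q ^ r * real q ^ k / real q ^ n))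
    \<le> 2 * real q * (real q ^ 2 * n powr (- \<epsilon>))
      + sqrt n * q * real (q * n) powr (2 * sqrt n) * q powr sqrt n * q powr (- real n / 2)"
proof -
  define x where "x = real q ^ 2 * n powr (- \<epsilon>)"
  define B where "B = q * real (q * n) powr (2 * sqrt n) * q powr sqrt n * q powr (- real n / 2)"
  have qn: "real (q * n) \<ge> 1"
  proof -
    have "1 * 1 \<le> q * n" using q n by (intro mult_le_mono) auto
    then have "real (1 * 1) \<le> real (q * n)" by (rule of_nat_mono)
    then show ?thesis by simp
  qed
  have B: "B \<ge> 0" by (simp add: B_def)
  have nk: "n powr (2 + \<epsilon>) \<le> real q ^ k"
  proof -
    have "n powr (2 + \<epsilon>) = (q powr log q n) powr (2 + \<epsilon>)"
      using q n by simp
    also have "\<dots> = q powr ((2 + \<epsilon>) * log q n)" by (simp add: powr_powr mult.commute)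
    also have "\<dots> \<le> q powr k" using k q by (intro powr_mono) auto
    also have "\<dots> = real q ^ k" using q by (simp add: powr_realpow)
    finally show ?thesis .
  qed
  have base: "real (q * n) ^ 2 / real q ^ k \<le> x"
  proof -
    have "real n ^ 2 = n powr 2" using n by (simp add: powr_numeral)
    also have "\<dots> = n powr (- \<epsilon>) * n powr (2 + \<epsilon>)" by (simp flip: powr_add)
    also have "\<dots> \<le> n powr (- \<epsilon>) * real q ^ k" using nk by (intro mult_left_mono) auto
    finally have "real n ^ 2 / real q ^ k \<le> n powr (- \<epsilon>)"
      using q by (simp add: pos_divide_le_eq)
    then have "real q ^ 2 * (real n ^ 2 / real q ^ k) \<le> x"
      unfolding x_def by (intro mult_left_mono) auto
    then show ?thesis by (simp add: power_mult_distrib)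
  qed
  have "q * real (q * n) ^ min (2 * r) n * (1 / real q ^ (r * k) + real q ^ r * real q ^ k / real q ^ n)
      \<le> q * x ^ r + B" if r: "r \<in> {1..R}" for r
  proof -
    have "real (q * n) ^ min (2 * r) n * (1 / real q ^ (r * k)) \<le> real (q * n) ^ (2 * r) * (1 / real q ^ (r * k))"
      using qn by (intro mult_right_mono power_increasing) auto
    also have "\<dots> = (real (q * n) ^ 2 / real q ^ k) ^ r"
      by (simp add: power_divide power_mult[symmetric] mult.commute)
    also have "\<dots> \<le> x ^ r" using base by (intro power_mono) auto
    finally have 1: "q * (real (q * n) ^ min (2 * r) n * (1 / real q ^ (r * k))) \<le> q * x ^ r"
      by (intro mult_left_mono) auto
    have rn: "real r \<le> sqrt n" using r R by simp
    have "real (q * n) ^ min (2 * r) n = (q * n) powr (min (2 * r) n)"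
      using qn by (subst powr_realpow) auto
    also have "\<dots> \<le> real (q * n) powr (2 * sqrt n)"
      using qn rn by (intro powr_mono) auto
    finally have 2: "real (q * n) ^ min (2 * r) n \<le> real (q * n) powr (2 * sqrt n)" .
    have "real q ^ r = q powr r" using q by (simp add: powr_realpow)
    also have "\<dots> \<le> q powr sqrt n" using q rn by (intro powr_mono) auto
    finally have 3: "real q ^ r \<le> q powr sqrt n" .
    have "real q ^ k / real q ^ n = q powr (real k - real n)"
      using q by (simp add: powr_realpow powr_diff)
    also have "\<dots> \<le> q powr (- real n / 2)" using q k by (intro powr_mono) auto
    finally have 4: "real q ^ k / real q ^ n \<le> q powr (- real n / 2)" .
    have "real (q * n) ^ min (2 * r) n * real q ^ r * (real q ^ k / real q ^ n)
        \<le> real (q * n) powr (2 * sqrt n) * q powr sqrt n * q powr (- real n / 2)"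
      using 2 3 4 by (intro mult_mono) auto
    then have "q * (real (q * n) ^ min (2 * r) n * real q ^ r * (real q ^ k / real q ^ n))
        \<le> q * (real (q * n) powr (2 * sqrt n) * q powr sqrt n * q powr (- real n / 2))"
      by (rule mult_left_mono) simp
    then have 5: "q * (real (q * n) ^ min (2 * r) n * real q ^ r * (real q ^ k / real q ^ n)) \<le> B"
      by (simp only: B_def mult.assoc)
    have "q * real (q * n) ^ min (2 * r) n * (1 / real q ^ (r * k) + real q ^ r * real q ^ k / real q ^ n)
      = q * (real (q * n) ^ min (2 * r) n * (1 / real q ^ (r * k)))
        + q * (real (q * n) ^ min (2 * r) n * real q ^ r * (real q ^ k / real q ^ n))"
      by (simp only: distrib_left mult.assoc times_divide_eq_right)
    with 1 5 show ?thesis by linarith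
  qed
  then have "(\<Sum>r=1..R. q * real (q * n) ^ min (2 * r) n * (1 / real q ^ (r * k) + real q ^ r * real q ^ k / real q ^ n))
    \<le> (\<Sum>r=1..R. q * x ^ r + B)" by (rule sum_mono)
  also have "\<dots> = q * (\<Sum>r=1..R. x ^ r) + R * B"
    by (simp add: sum.distrib sum_distrib_left)
  also have "\<dots> \<le> q * (2 * x) + sqrt n * B"
    using x R B by (intro add_mono mult_left_mono mult_right_mono sum_power_le_double) (auto simp: x_def)
  finally show ?thesis by (simp add: x_def B_def mult_ac)
qed

text \<open>Compares exponents of q: the number of maps contributes 1 + min (2r) n * (1 + L), the
  target n^(-2) a further 2L, and the saving is g * j. The target is n^(-2) so that at most n terms
  sum to 1/n. The hypotheses \<open>h0\<close> to \<open>h4\<close> hold for all large n.\<close>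

lemma large_rank_term_le:
  fixes q n k r j J :: nat and \<epsilon> L :: real
  assumes q: "q \<ge> 2" and n: "n \<ge> 1" and L: "L = log q n" and \<epsilon>: "\<epsilon> > 0"
    and k: "2 * k \<le> n" "(2 + \<epsilon>) * L \<le> k"
    and J: "J = nat \<lceil>(4 + 2 * \<epsilon>) * L\<rceil>" and j: "j = min k J"
    and r: "sqrt n \<le> r"
    and h0: "((4 + 2 * \<epsilon>) * L + 1) + 3 \<le> sqrt n"
    and h1: "\<epsilon> * L - 2 \<ge> 0"
    and h2: "(sqrt n - ((4 + 2 * \<epsilon>) * L + 1) - 3) * ((2 + \<epsilon>) * L) \<ge> 2 * sqrt n * (1 + L) + 1 + 2 * L"
    and h3: "(n - ((4 + 2 * \<epsilon>) * L + 1) - 3) / 2 * ((2 + \<epsilon>) * L) \<ge> n * (1 + L) + 1 + 2 * L"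
    and h4: "(n / 2 - 3) / 2 * ((4 + 2 * \<epsilon>) * L) \<ge> n * (1 + L) + 1 + 2 * L"
    and n6: "n \<ge> 6"
  shows "j + 3 \<le> r"
    and "q * real (q * n) ^ min (2 * r) n * (1 / real q ^ (min (r - j - 3) ((n - k - 2) div 2) * j)) \<le> 1 / real n ^ 2"
proof -
  have L0: "L \<ge> 0" using q n L by simp
  have JL: "(4 + 2 * \<epsilon>) * L \<le> J" "J \<le> (4 + 2 * \<epsilon>) * L + 1"
  proof -
    have "(4 + 2 * \<epsilon>) * L \<ge> 0" using L0 \<epsilon> by simp
    then show "(4 + 2 * \<epsilon>) * L \<le> J" "J \<le> (4 + 2 * \<epsilon>) * L + 1"
      unfolding J by linarith+
  qed
  have jL: "(2 + \<epsilon>) * L \<le> j"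
  proof -
    have "(2 + \<epsilon>) * L \<le> (4 + 2 * \<epsilon>) * L" using L0 \<epsilon> by (intro mult_right_mono) auto
    then show ?thesis using JL k by (simp add: j)
  qed
  have jJ: "real j \<le> (4 + 2 * \<epsilon>) * L + 1" using JL by (simp add: j)
  have "real (j + 3) \<le> r" using jJ h0 r by simp
  then show jr: "j + 3 \<le> r" by linarith
  define g where "g = min (r - j - 3) ((n - k - 2) div 2)"
  have \<epsilon>L: "(2 + \<epsilon>) * L \<ge> 0" using L0 \<epsilon> by simp
  have key: "1 + real (min (2 * r) n) * (1 + L) + 2 * L \<le> real g * real j"
  proof (cases "r - j - 3 \<le> (n - k - 2) div 2")
    case True
    then have g: "real g = real r - real j - 3" using jr by (simp add: g_def of_nat_diff)
    have "1 + real (min (2 * r) n) * (1 + L) + 2 * L \<le> 1 + (2 * real r) * (1 + L) + 2 * L"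
      using L0 by (intro add_mono mult_right_mono) auto
    also have "\<dots> \<le> (real r - ((4 + 2 * \<epsilon>) * L + 1) - 3) * ((2 + \<epsilon>) * L)"
    proof -
      \<comment> \<open>Both sides are linear in r, with slopes differing by \<epsilon> L - 2 \<ge>
        0, so it suffices to compare them at sqrt n, which is \<open>h2\<close>.\<close>
      have "sqrt n * (\<epsilon> * L - 2) \<le> r * (\<epsilon> * L - 2)" using r h1 by (rule mult_right_mono)
      with h2 show ?thesis by (simp add: algebra_simps)
    qed
    also have "\<dots> \<le> real g * real j"
      using g jJ jL \<epsilon>L h0 r by (intro mult_mono) auto
    finally show ?thesis .
  next
    case False
    then have "g = (n - k - 2) div 2" by (simp add: g_def)
    \<comment> \<open>3 instead of 2 absorbs the rounding of \<open>div 2\<close>.\<close>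
    then have "n \<le> 2 * g + 3 + k" by presburger
    then have "real n \<le> real (2 * g + 3 + k)" by (rule of_nat_mono)
    then have g: "real g \<ge> (real n - real k - 3) / 2" by simp
    have "1 + real (min (2 * r) n) * (1 + L) + 2 * L \<le> n * (1 + L) + 1 + 2 * L"
      using L0 mult_right_mono[of "real (min (2 * r) n)" n "1 + L"] by simp
    also have "\<dots> \<le> real g * real j"
    \<comment> \<open>For small k, g is about n/2 and j = k \<ge> (2 + \<epsilon>) L; for large k, g
      is at least about n/4 and j = J \<ge> (4 + 2\<epsilon>) L. Either product is about (1 +
      \<epsilon>/2) n L or more.\<close>
    proof (cases "k \<le> J")
      case True
      have "n * (1 + L) + 1 + 2 * L \<le> (n - ((4 + 2 * \<epsilon>) * L + 1) - 3) / 2 * ((2 + \<epsilon>) * L)" by (rule h3)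
      also have "\<dots> \<le> real g * real j"
        using g True JL jL \<epsilon>L by (intro mult_mono) auto
      finally show ?thesis .
    next
      case False
      have "n * (1 + L) + 1 + 2 * L \<le> (n / 2 - 3) / 2 * ((4 + 2 * \<epsilon>) * L)" by (rule h4)
      also have "\<dots> \<le> real g * real j"
        using g False JL k L0 \<epsilon> n6 by (intro mult_mono) (auto simp: j)
      finally show ?thesis .
    qed
    finally show ?thesis .
  qed
  have nL: "real n = q powr L" using q n L by simp
  have "q * real (q * n) ^ min (2 * r) n = q powr (1 + real (min (2 * r) n) * (1 + L))"
  proof -
    have "real (q * n) = q powr (1 + L)" using q nL by (simp add: powr_add)
    then have "real (q * n) ^ min (2 * r) n = (q powr (1 + L)) powr (real (min (2 * r) n))"
      using q by (subst powr_realpow) auto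
    then show ?thesis unfolding powr_powr using q by (simp add: powr_add mult.commute[of "1 + L"])
  qed
  also have "\<dots> \<le> q powr (real g * real j - 2 * L)"
    using key q by (intro powr_mono) auto
  also have "\<dots> = real q ^ (g * j) / real n ^ 2"
  proof -
    have "q powr (real g * real j) = real q ^ (g * j)"
      using q by (simp flip: powr_realpow)
    moreover have "q powr (2 * L) = real n ^ 2"
      unfolding nL using q by (simp add: powr_power mult.commute)
    ultimately show ?thesis by (simp add: powr_diff)
  qed
  finally show "q * real (q * n) ^ min (2 * r) n * (1 / real q ^ (min (r - j - 3) ((n - k - 2) div 2) * j)) \<le> 1 / real n ^ 2"
    using q unfolding g_def[symmetric] by (simp add: field_simps)
qed

text \<open>\<beta> and the threshold on n are uniform in k, so the bound may be used at k or at n -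
  k, whichever is smaller, separately for each n.\<close>

lemma union_bound_tendsto_0:
  fixes q :: nat and \<epsilon> :: real
  assumes q: "q \<ge> 2" and \<epsilon>: "\<epsilon> > 0"
  obtains \<beta> :: "nat \<Rightarrow> real" where "\<beta> \<longlonglongrightarrow> 0"
    and "\<forall>\<^sub>F n in sequentially. \<forall>k. 2 * k \<le> n \<longrightarrow> (2 + \<epsilon>) * log q n \<le> k \<longrightarrow>
      (\<exists>j R. j \<le> k \<and> (\<forall>r. R < r \<longrightarrow> j + 3 \<le> r) \<and>
        (\<Sum>r=1..n. q * real (q * n) ^ min (2 * r) n * union_term q n k j R r) \<le> \<beta> n)"
proof -
  define c where "c = 1 / ln (real q)"
  define \<beta> where "\<beta> n = (2 * real q * (real q ^ 2 * real n powr (- \<epsilon>))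
    + sqrt n * q * real (q * n) powr (2 * sqrt n) * q powr sqrt n * q powr (- real n / 2)) + 1 / n" for n :: nat
  have Q: "real q \<ge> 2" using q by simp
  have c: "c > 0" using q by (simp add: c_def)
  have log: "log q n = c * ln n" for n :: nat by (simp add: c_def log_def)
  have "(\<lambda>n::nat. 2 * x * (x ^ 2 * real n powr (- \<epsilon>))) \<longlonglongrightarrow> 0"
    "(\<lambda>n::nat. sqrt n * x * (x * real n) powr (2 * sqrt n) * x powr sqrt n * x powr (- real n / 2)) \<longlonglongrightarrow> 0"
    "(\<lambda>n::nat. 1 / real n) \<longlonglongrightarrow> 0"
    if "x \<ge> 2" for x :: real
    using that \<epsilon> by real_asymp+
  from this[OF Q] have lim: "\<beta> \<longlonglongrightarrow> 0"
    unfolding \<beta>_def of_nat_mult by (intro tendsto_add_zero)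
  have "\<forall>\<^sub>F n in sequentially. real q ^ 2 * real n powr (- \<epsilon>) \<le> 1 / 2"
    using Q c \<epsilon> by real_asymp
  moreover have "\<forall>\<^sub>F n in sequentially. ((4 + 2 * \<epsilon>) * (c * ln (real n)) + 1) + 3 \<le> sqrt n"
    using c \<epsilon> by real_asymp
  moreover have "\<forall>\<^sub>F n in sequentially. \<epsilon> * (c * ln (real n)) - 2 \<ge> 0"
    using c \<epsilon> by real_asymp
  moreover have "\<forall>\<^sub>F n in sequentially. (sqrt (real n) - ((4 + 2 * \<epsilon>) * (c * ln (real n)) + 1) - 3) * ((2 + \<epsilon>) * (c * ln (real n)))
      \<ge> 2 * sqrt (real n) * (1 + c * ln (real n)) + 1 + 2 * (c * ln (real n))"
    using c \<epsilon> by real_asymp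
  moreover have "\<forall>\<^sub>F n in sequentially. (real n - ((4 + 2 * \<epsilon>) * (c * ln (real n)) + 1) - 3) / 2 * ((2 + \<epsilon>) * (c * ln (real n)))
      \<ge> real n * (1 + c * ln (real n)) + 1 + 2 * (c * ln (real n))"
    using c \<epsilon> by real_asymp
  moreover have "\<forall>\<^sub>F n in sequentially. (real n / 2 - 3) / 2 * ((4 + 2 * \<epsilon>) * (c * ln (real n)))
      \<ge> real n * (1 + c * ln (real n)) + 1 + 2 * (c * ln (real n))"
    using c \<epsilon> by real_asymp
  moreover have "\<forall>\<^sub>F n in sequentially. (6::nat) \<le> n"
    by (rule eventually_ge_at_top)
  ultimately have "\<forall>\<^sub>F n in sequentially. \<forall>k. 2 * k \<le> n \<longrightarrow> (2 + \<epsilon>) * log q n \<le> k \<longrightarrow>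
      (\<exists>j R. j \<le> k \<and> (\<forall>r. R < r \<longrightarrow> j + 3 \<le> r) \<and>
        (\<Sum>r=1..n. q * real (q * n) ^ min (2 * r) n * union_term q n k j R r) \<le> \<beta> n)"
  proof eventually_elim
    case (elim n)
    note h = elim(2-6)[folded log]
    have "\<exists>j R. j \<le> k \<and> (\<forall>r. R < r \<longrightarrow> j + 3 \<le> r) \<and>
        (\<Sum>r=1..n. q * real (q * n) ^ min (2 * r) n * union_term q n k j R r) \<le> \<beta> n"
      if k: "2 * k \<le> n" "(2 + \<epsilon>) * log q n \<le> k" for k
    proof -
      define R where "R = nat \<lfloor>sqrt n\<rfloor>"
      define J where "J = nat \<lceil>(4 + 2 * \<epsilon>) * log q n\<rceil>"
      define j where "j = min k J"
      have n: "n \<ge> 1" using elim by simp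
      have R: "real R \<le> sqrt n" unfolding R_def by simp
      have Rr: "sqrt n \<le> real r" if "R < r" for r using that unfolding R_def by linarith
      have "sqrt n \<le> n" using n by (intro real_le_lsqrt) (auto simp: power2_eq_square simp flip: of_nat_mult)
      then have Rn: "R \<le> n" using R by linarith
      note big = large_rank_term_le[OF q n refl \<epsilon> k J_def j_def Rr h elim(7)]
      have "(\<Sum>r=1..n. q * real (q * n) ^ min (2 * r) n * union_term q n k j R r)
        = (\<Sum>r=1..R. q * real (q * n) ^ min (2 * r) n * union_term q n k j R r)
         + (\<Sum>r=Suc R..n. q * real (q * n) ^ min (2 * r) n * union_term q n k j R r)"
        using Rn by (subst sum.union_disjoint[symmetric]) (auto intro!: sum.cong)
      also have "(\<Sum>r=1..R. q * real (q * n) ^ min (2 * r) n * union_term q n k j R r)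
        = (\<Sum>r=1..R. q * real (q * n) ^ min (2 * r) n * (1 / real q ^ (r * k) + real q ^ r * real q ^ k / real q ^ n))"
        by (intro sum.cong) (auto simp: union_term_def)
      also have "\<dots> \<le> 2 * real q * (real q ^ 2 * n powr (- \<epsilon>))
        + sqrt n * q * real (q * n) powr (2 * sqrt n) * q powr sqrt n * q powr (- real n / 2)"
        by (rule small_rank_sum_le[OF q n k R elim(1)])
      also have "(\<Sum>r=Suc R..n. q * real (q * n) ^ min (2 * r) n * union_term q n k j R r) \<le> 1 / n"
      proof -
        have "(\<Sum>r=Suc R..n. q * real (q * n) ^ min (2 * r) n * union_term q n k j R r) \<le> (\<Sum>r=Suc R..n. 1 / real n ^ 2)"
          using big(2) by (intro sum_mono) (auto simp: union_term_def)
        also have "\<dots> \<le> real n * (1 / real n ^ 2)"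
          by (simp add: divide_right_mono)
        also have "\<dots> = 1 / n" using n by (simp add: power2_eq_square)
        finally show ?thesis .
      qed
      finally have "(\<Sum>r=1..n. q * real (q * n) ^ min (2 * r) n * union_term q n k j R r) \<le> \<beta> n"
        by (simp add: \<beta>_def)
      moreover have "j \<le> k" by (simp add: j_def)
      ultimately show ?thesis using big(1) by blast
    qed
    then show ?case by blast
  qed
  with lim that show ?thesis by blast
qed

section \<open>Union bound over monomial maps\<close>

lemma card_symmetric_codes_union_bound:
  fixes n k j R :: nat
  assumes k: "2 * k \<le> n" "j \<le> k" and n: "n \<ge> 4" and R: "\<And>r. R < r \<Longrightarrow> j + 3 \<le> r"
  defines "q \<equiv> CARD('a :: {finite, field})"
  shows "real (card (symmetric_codes n k :: (nat \<Rightarrow> 'a) set set))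
    \<le> gbinom q n k 0 * (\<Sum>r=1..n. q * real (q * n) ^ min (2 * r) n * union_term q n k j R r)"
proof -
  have q: "q \<ge> 2" unfolding q_def by (rule CARD_field_ge_2)
  have kn: "k \<le> n" using k by simp
  let ?P = "\<lambda>r. gbinom q n k 0 * union_term q n k j R r"
  have "real (card (symmetric_codes n k :: (nat \<Rightarrow> 'a) set set))
    \<le> (\<Sum>r=1..n. real q * real (q * n) ^ min (2 * r) n * ?P r)"
    unfolding q_def
  proof (rule card_symmetric_codes_le)
    show "0 \<le> gbinom CARD('a) n k 0 * union_term CARD('a) n k j R r" for r
      using gbinom_nonneg[OF CARD_field_ge_2[where 'a = 'a] kn, of 0] by (simp add: union_term_def)
    fix p :: "(nat \<Rightarrow> 'a) \<times> (nat \<Rightarrow> nat)" and c :: 'a and r :: nat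
    assume p: "p \<in> monomials n" and r: "1 \<le> r" "r \<le> n"
      and E: "card {f \<in> words n. mono_act p f = fun_scale c f} = CARD('a) ^ (n - r)"
      and E': "\<And>c'. card {f \<in> words n. mono_act p f = fun_scale c' f} \<le> CARD('a) ^ (n - r)"
    interpret finite_field_endo "fun_scale :: 'a \<Rightarrow> _" "words n" n "mono_act p"
      by (rule finite_field_endo_mono_act[OF p])
    have "real (card (invariant_subspaces k)) \<le> gbinom CARD('a) n k 0 * union_term CARD('a) n k j R r"
    proof (cases "r \<le> R")
      case True
      then show ?thesis
        using card_invariant_le_small_rank[of c r k] E r kn by (simp add: union_term_def eigenspace_def)
    next
      case False
      let ?g = "min (r - j - 3) ((n - k - 2) div 2)"
      \<comment> \<open>\<open>n \<ge> 4\<close> and \<open>2 * k \<le> n\<close> give n - k \<ge>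
        2, so the subtraction in \<open>?g\<close> does not truncate.\<close>
      have "?g + j + 3 \<le> r" "2 * ?g + 2 \<le> n - k"
        using R[of r] False k n by auto
      then have "real (card (invariant_subspaces k)) \<le> gbinom CARD('a) n k 0 / real CARD('a) ^ (?g * j)"
        using E' r k kn by (intro card_invariant_le_large_rank[of r]) (auto simp: eigenspace_def)
      then show ?thesis using False by (simp add: union_term_def)
    qed
    then show "real (card {C \<in> word_space.subspaces_of (words n) k. \<forall>x\<in>C. mono_act p x \<in> C})
        \<le> gbinom CARD('a) n k 0 * union_term CARD('a) n k j R r"
      by (simp add: invariant_subspaces_def)
  qed
  also have "\<dots> = gbinom q n k 0 * (\<Sum>r=1..n. q * real (q * n) ^ min (2 * r) n * union_term q n k j R r)"
    by (simp add: sum_distrib_left mult_ac)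
  finally show ?thesis .
qed

lemma card_subspaces_of_words:
  "real (card (word_space.subspaces_of (words n :: (nat \<Rightarrow> 'a :: {finite, field}) set) k)) = gbinom CARD('a) n k 0"
  by (rule word_space.card_subspaces_of[OF finite_words subspace_words card_words])

theorem mainTheorem1:
  fixes k :: "nat \<Rightarrow> nat" and \<epsilon> :: real and q :: nat
  assumes "q = CARD('a :: {finite, field})"
    and "\<epsilon> > 0"
    and "\<And>n. n \<ge> 1 \<Longrightarrow> 1 \<le> k n \<and> k n \<le> n"
    and "\<forall>\<^sub>F n in sequentially. real (min (k n) (n - k n)) \<ge> (2 + \<epsilon>) * log (real q) (real n)"
  shows "(\<lambda>n. measure_pmf.prob (random_code n (k n) :: 'a Matrix.vec set pmf)
                {C. MAut n C = MAut0 n}) \<longlonglongrightarrow> 1"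
proof -
  have q: "q \<ge> 2" unfolding assms(1) by (rule CARD_field_ge_2)
  let ?S = "\<lambda>n k. card (symmetric_codes n k :: (nat \<Rightarrow> 'a) set set)"
  let ?G = "\<lambda>n k. card (word_space.subspaces_of (words n :: (nat \<Rightarrow> 'a) set) k)"
  obtain \<beta> :: "nat \<Rightarrow> real" where \<beta>: "\<beta> \<longlonglongrightarrow> 0"
    and ev: "\<forall>\<^sub>F n in sequentially. \<forall>k. 2 * k \<le> n \<longrightarrow> (2 + \<epsilon>) * log q n \<le> k \<longrightarrow>
      (\<exists>j R. j \<le> k \<and> (\<forall>r. R < r \<longrightarrow> j + 3 \<le> r) \<and>
        (\<Sum>r=1..n. q * real (q * n) ^ min (2 * r) n * union_term q n k j R r) \<le> \<beta> n)"
    by (rule union_bound_tendsto_0[OF q assms(2)])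
  have "\<forall>\<^sub>F n in sequentially. (4::nat) \<le> n" by (rule eventually_ge_at_top)
  with ev assms(4) have low: "\<forall>\<^sub>F n in sequentially. 1 - \<beta> n \<le>
    measure_pmf.prob (random_code n (k n) :: 'a Matrix.vec set pmf) {C. MAut n C = MAut0 n}"
  proof eventually_elim
    case (elim n)
    have kn: "k n \<le> n" using assms(3)[of n] elim by simp
    \<comment> \<open>Stated for any dimension up to n/2, to be applied to \<open>k n\<close> or to
      its dual dimension.\<close>
    have half: "real (?S n k') \<le> real (?G n k') * \<beta> n"
      if k': "2 * k' \<le> n" "(2 + \<epsilon>) * log q n \<le> k'" for k'
    proof -
      obtain j R where jR: "j \<le> k'" "\<And>r. R < r \<Longrightarrow> j + 3 \<le> r"
        "(\<Sum>r=1..n. q * real (q * n) ^ min (2 * r) n * union_term q n k' j R r) \<le> \<beta> n"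
        using elim(1) k' by blast
      have "real (?S n k') \<le> gbinom q n k' 0 * (\<Sum>r=1..n. q * real (q * n) ^ min (2 * r) n * union_term q n k' j R r)"
        using card_symmetric_codes_union_bound[where 'a = 'a, OF k'(1) jR(1) elim(3) jR(2)] by (simp add: assms(1))
      also have "\<dots> \<le> gbinom q n k' 0 * \<beta> n"
        using k' by (intro mult_left_mono[OF jR(3)] gbinom_nonneg[OF q]) simp
      finally show ?thesis by (simp add: card_subspaces_of_words assms(1))
    qed
    have "real (?S n (k n)) \<le> real (?G n (k n)) * \<beta> n"
    proof (cases "2 * k n \<le> n")
      case True
      moreover have "real (min (k n) (n - k n)) \<le> real (k n)" by simp
      ultimately show ?thesis using elim(2) by (intro half) linarith+
    next
      case False
      have le: "?S n (k n) \<le> ?S n (n - k n)" "?G n (k n) = ?G n (n - k n)"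
        using card_symmetric_codes_dual[where 'a = 'a, of "k n" n]
          card_symmetric_codes_dual(2)[where 'a = 'a, of "n - k n" n] kn by auto
      have "real (?S n (k n)) \<le> real (?S n (n - k n))" using le(1) by simp
      also have "\<dots> \<le> real (?G n (n - k n)) * \<beta> n"
      proof (rule half)
        show "2 * (n - k n) \<le> n" using False by linarith
        have "real (min (k n) (n - k n)) \<le> real (n - k n)" by simp
        then show "(2 + \<epsilon>) * log q n \<le> real (n - k n)" using elim(2) by linarith
      qed
      finally show ?thesis unfolding le(2) .
    qed
    moreover have "real (?G n (k n)) > 0"
      unfolding card_subspaces_of_words using kn CARD_field_ge_2[where 'a = 'a] by (intro gbinom_pos) auto
    ultimately have "real (?S n (k n)) / real (?G n (k n)) \<le> \<beta> n"
      by (simp add: pos_divide_le_eq mult.commute)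
    then show ?case
      using prob_trivial_MAut_ge[where 'a = 'a, of n "k n"] kn elim by linarith
  qed
  have "(\<lambda>n. 1 - \<beta> n) \<longlonglongrightarrow> 1 - 0" using \<beta> by (intro tendsto_diff tendsto_const)
  then show ?thesis
    by (intro tendsto_sandwich[OF low, of "\<lambda>_. 1"]) auto
qed

end
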